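(* For all $n \in \omega$, $${}^1(\mathsf{TJ}^{(n)}) \equiv_{\mathrm{sW}} \mathsf{C}_{\mathbb{N}}^{(n)}.$$
   Context: A problem is a partial multifunction $\mathsf{P} :\subseteq \omega^\omega \rightrightarrows \omega^\omega$. Each $f \in \mathrm{dom}(\mathsf{P})$ (so $\mathsf{P}(f) \neq \emptyset$) is a $\mathsf{P}$-instance, and each $g \in \mathsf{P}(f)$ is a $\mathsf{P}$-solution to $f$. Sets are identified with their characteristic functions. The set $\omega$ is embedded in $\omega^\omega$ by identifying $x \in \omega$ with the $f \in \omega^\omega$ such that $f(0)=x$ and $f(y)=0$ for all $y>0$. Angle brackets denote Turing joins. Turing functionals are regarded as partial maps $\omega^\omega \to \omega^\omega$, $\Psi(f,g)$ means $\Psi(\langle f,g\rangle)$, and $\Psi(f)(x)$ is the value at $x$ of the computation with oracle $f$. When a Turing functional is part of an instance, it is given by an index in a fixed computable listing of all Turing functionals. $\mathsf{Q} \leq_{\mathrm{sW}} \mathsf{P}$ (strongly Weihrauch reducible) if there are Turing functionals $\Phi,\Psi$ such that for all $f \in \mathrm{dom}(\mathsf{Q})$ we have $\Phi(f) \in \mathrm{dom}(\mathsf{P})$, and for every $g \in \mathsf{P}(\Phi(f))$ we have $\Psi(g) \in \mathsf{Q}(f)$. $\equiv_{\mathrm{sW}}$ is the induced equivalence relation. The first-order part ${}^1\mathsf{P}$ of a problem $\mathsf{P}$ is the following problem. Its instances are all triples $\langle f,\Phi,\Psi\rangle$, where $f \in \omega^\omega$ and $\Phi,\Psi$ are Turing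 functionals such that $\Phi(f) \in \mathrm{dom}(\mathsf{P})$ and $\Psi(f,g)(0)\downarrow$ for all $g \in \mathsf{P}(\Phi(f))$. The solutions to such an instance are all $y \in \omega$ such that $\Psi(f,g)(0)\downarrow = y$ for some $g \in \mathsf{P}(\Phi(f))$. The jump $\mathsf{P}'$ of a problem $\mathsf{P}$ has as instances all pairs $\langle f,i\rangle$ such that $f \in \omega^\omega$ and $i$ is a $\Delta^{0,f}_2$ index for a $\mathsf{P}$-instance $g$; the solutions to $\langle f,i\rangle$ are all the $\mathsf{P}$-solutions to $g$. $\mathsf{P}^{(0)}=\mathsf{P}$ and $\mathsf{P}^{(n+1)}=(\mathsf{P}^{(n)})'$. $\mathsf{TJ}$ (the Turing jump problem): instances are all $g \in \omega^\omega$; the unique solution to $g$ is its Turing jump $g'$. ($\mathsf{TJ}^{(n)}$ denotes the $n$-th jump of $\mathsf{TJ}$ as a problem.) $\mathsf{C}_{\mathbb{N}}$ (choice on $\omega$): instances are all enumerations of proper subsets of $\omega$; solutions are all $i \in \omega$ that are not enumerated. Explicitly, an instance is a function $v$ on $\omega$ whose values are natural numbers or a special symbol meaning that nothing has been enumerated yet, with $\omega \nsubseteq \mathrm{ran}(v)$, such that the special symbol is never taken after a different value, and if $v(s)=v(t)$ for some $s<t$ then $v$ is constant on $[s,t]$; the solutions are the $i \in \omega$ with $i \notin \mathrm{ran}(v)$. *)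

theory Defs
  imports Main "HOL-Library.Nat_Bijection"
begin

section \<open>Turing functionals\<close>

text \<open>
  Turing functionals are presented as the unary partial functions that are partial recursive
  relative to an element of Baire space. Several arguments are passed through the
  Cantor pairing bijection \<open>prod_encode\<close>; \<open>Query\<close> consults the given element of Baire space.
\<close>

type_synonym baire = "nat \<Rightarrow> nat"

datatype prog =
    Zero
  | Succ
  | Fst
  | Snd
  | Query
  | Pair prog prog
  | Comp prog prog
  | PrimRec prog prog
  | Mu prog

primrec run :: "baire \<Rightarrow> prog \<Rightarrow> nat \<rightharpoonup> nat" where
  "run f Zero x = Some 0"
| "run f Succ x = Some (Suc x)"
| "run f Fst x = Some (fst (prod_decode x))"
| "run f Snd x = Some (snd (prod_decode x))"
| "run f Query x = Some (f x)"
| "run f (Pair p q) x =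
     Option.bind (run f p x) (\<lambda>y. Option.bind (run f q x) (\<lambda>z. Some (prod_encode (y, z))))"
| "run f (Comp p q) x = Option.bind (run f q x) (run f p)"
| "run f (PrimRec p q) x =
     (let (a, n) = prod_decode x in
      rec_nat (run f p a)
        (\<lambda>m r. Option.bind r (\<lambda>y. run f q (prod_encode (a, prod_encode (m, y))))) n)"
| "run f (Mu p) x =
     (if \<exists>n. run f p (prod_encode (x, n)) = Some 0 \<and>
             (\<forall>m<n. run f p (prod_encode (x, m)) \<noteq> None)
      then Some (LEAST n. run f p (prod_encode (x, n)) = Some 0)
      else None)"

text \<open>The fixed computable listing of all programs.\<close>

function prog_of :: "nat \<Rightarrow> prog" where
  "prog_of e =
     (if e = 0 then Zero
      else if e = 1 then Succ
      else if e = 2 then Fst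
      else if e = 3 then Snd
      else if e = 4 then Query
      else let k = (e - 5) div 4; a = fst (prod_decode k); b = snd (prod_decode k) in
        if (e - 5) mod 4 = 0 then Pair (prog_of a) (prog_of b)
        else if (e - 5) mod 4 = 1 then Comp (prog_of a) (prog_of b)
        else if (e - 5) mod 4 = 2 then PrimRec (prog_of a) (prog_of b)
        else Mu (prog_of k))"
  by auto

lemma fst_prod_decode_le: "fst (prod_decode k) \<le> k"
  by (metis le_prod_encode_1 prod.collapse prod_decode_inverse)

lemma snd_prod_decode_le: "snd (prod_decode k) \<le> k"
  by (metis le_prod_encode_2 prod.collapse prod_decode_inverse)

termination prog_of
proof (relation "measure id")
  show "wf (measure (id :: nat \<Rightarrow> nat))" by simp
qed (auto intro!: le_less_trans[OF fst_prod_decode_le] le_less_trans[OF snd_prod_decode_le])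

declare prog_of.simps [simp del]

lemma surj_prog_of: "surj prog_of"
proof -
  have bin: "(5 + (4 * k + r) - 5) div 4 = k" "(5 + (4 * k + r) - 5) mod 4 = r"
    if "r < 4" for k r :: nat
    using that by auto
  have "\<exists>e. prog_of e = p" for p
  proof (induction p)
    case Zero
    show ?case by (rule exI[of _ 0]) (simp add: prog_of.simps)
  next
    case Succ
    show ?case by (rule exI[of _ 1]) (simp add: prog_of.simps)
  next
    case Fst
    show ?case by (rule exI[of _ 2]) (simp add: prog_of.simps)
  next
    case Snd
    show ?case by (rule exI[of _ 3]) (simp add: prog_of.simps)
  next
    case Query
    show ?case by (rule exI[of _ 4]) (simp add: prog_of.simps)
  next
    case (Pair p q)
    then obtain a b where "prog_of a = p" "prog_of b = q" by blast
    then show ?case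
      by (intro exI[of _ "5 + (4 * prod_encode (a, b) + 0)"])
        (subst prog_of.simps, simp add: Let_def)
  next
    case (Comp p q)
    then obtain a b where "prog_of a = p" "prog_of b = q" by blast
    then show ?case
      using bin[of 1 "prod_encode (a, b)"]
      by (intro exI[of _ "5 + (4 * prod_encode (a, b) + 1)"])
        (subst prog_of.simps, simp add: Let_def)
  next
    case (PrimRec p q)
    then obtain a b where "prog_of a = p" "prog_of b = q" by blast
    then show ?case
      using bin[of 2 "prod_encode (a, b)"]
      by (intro exI[of _ "5 + (4 * prod_encode (a, b) + 2)"])
        (subst prog_of.simps, simp add: Let_def)
  next
    case (Mu p)
    then obtain a where "prog_of a = p" by blast
    then show ?case
      using bin[of 3 a]
      by (intro exI[of _ "5 + (4 * a + 3)"])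
        (subst prog_of.simps, simp add: Let_def)
  qed
  then show ?thesis by (metis surjI)
qed

text \<open>\<open>Phi e f x\<close> is the value at \<open>x\<close> of the \<open>e\<close>-th Turing functional with input \<open>f\<close>.\<close>

definition Phi :: "nat \<Rightarrow> baire \<Rightarrow> nat \<rightharpoonup> nat" where
  "Phi e f = run f (prog_of e)"

text \<open>As a partial map on Baire space, the \<open>e\<close>-th functional is defined at \<open>f\<close> iff \<open>Phi e f\<close> is total.\<close>

definition maps_to :: "nat \<Rightarrow> baire \<Rightarrow> baire \<Rightarrow> bool" where
  "maps_to e f g \<longleftrightarrow> (\<forall>x. Phi e f x = Some (g x))"

definition turing_join :: "baire \<Rightarrow> baire \<Rightarrow> baire" where
  "turing_join f g n = (if even n then f (n div 2) else g (n div 2))"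

definition emb :: "nat \<Rightarrow> baire" where
  "emb x n = (if n = 0 then x else 0)"

definition turing_jump :: "baire \<Rightarrow> baire" where
  "turing_jump g e = (if Phi e g e \<noteq> None then 1 else 0)"

section \<open>Problems\<close>

text \<open>A partial multifunction, with empty value outside its domain.\<close>

type_synonym problem = "baire \<Rightarrow> baire set"

definition instances :: "problem \<Rightarrow> baire set" where
  "instances P = {f. P f \<noteq> {}}"

definition sW_le :: "problem \<Rightarrow> problem \<Rightarrow> bool" (infix "\<le>sW" 50) where
  "Q \<le>sW P \<longleftrightarrow>
     (\<exists>d e. \<forall>f\<in>instances Q. \<exists>k. maps_to d f k \<and> k \<in> instances P \<and>
        (\<forall>g\<in>P k. \<exists>u. maps_to e g u \<and> u \<in> Q f))"

definition sW_equiv :: "problem \<Rightarrow> problem \<Rightarrow> bool" (infix "\<equiv>sW" 50) where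
  "Q \<equiv>sW P \<longleftrightarrow> Q \<le>sW P \<and> P \<le>sW Q"

text \<open>
  Functionals occurring in an instance are given by their indices, and the triple
  \<open>\<langle>f, \<Phi>, \<Psi>\<rangle>\<close> is the nested join \<open>\<langle>f, \<langle>\<Phi>, \<Psi>\<rangle>\<rangle>\<close>.
\<close>

definition first_order_instance :: "problem \<Rightarrow> baire \<Rightarrow> nat \<Rightarrow> nat \<Rightarrow> bool" where
  "first_order_instance P f d e \<longleftrightarrow>
     (\<exists>k. maps_to d f k \<and> k \<in> instances P \<and> (\<forall>g\<in>P k. Phi e (turing_join f g) 0 \<noteq> None))"

definition first_order_part :: "problem \<Rightarrow> problem" where
  "first_order_part P h =
     {emb y | y f d e k g.
        h = turing_join f (turing_join (emb d) (emb e)) \<and> first_order_instance P f d e \<and>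
        maps_to d f k \<and> g \<in> P k \<and> Phi e (turing_join f g) 0 = Some y}"

text \<open>A \<open>\<Delta>\<^sub>2\<close> index of \<open>g\<close> relative to \<open>f\<close> is an index for computing \<open>g\<close> from the Turing jump of \<open>f\<close>.\<close>

definition Delta2_index :: "baire \<Rightarrow> nat \<Rightarrow> baire \<Rightarrow> bool" where
  "Delta2_index f i g \<longleftrightarrow> maps_to i (turing_jump f) g"

definition jump :: "problem \<Rightarrow> problem" where
  "jump P h = {u. \<exists>f i g. h = turing_join f (emb i) \<and> Delta2_index f i g \<and>
                          g \<in> instances P \<and> u \<in> P g}"

definition iter_jump :: "problem \<Rightarrow> nat \<Rightarrow> problem" where
  "iter_jump P n = (jump ^^ n) P"

definition TJ :: problem where
  "TJ g = {turing_jump g}"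

text \<open>\<open>None\<close> is the special symbol meaning that nothing has been enumerated yet.\<close>

definition proper_enumeration :: "(nat \<Rightarrow> nat option) \<Rightarrow> bool" where
  "proper_enumeration v \<longleftrightarrow>
     \<not> range Some \<subseteq> range v \<and>
     (\<forall>s t. s < t \<and> v s \<noteq> None \<longrightarrow> v t \<noteq> None) \<and>
     (\<forall>s t. s < t \<and> v s = v t \<longrightarrow> (\<forall>r\<in>{s..t}. v r = v s))"

text \<open>In Baire space the special symbol is coded by \<open>0\<close> and the value \<open>i\<close> by \<open>Suc i\<close>.\<close>

definition code_enumeration :: "(nat \<Rightarrow> nat option) \<Rightarrow> baire" where
  "code_enumeration v s = (case v s of None \<Rightarrow> 0 | Some i \<Rightarrow> Suc i)"

definition C_N :: problem where
  "C_N h = {emb i | i v. h = code_enumeration v \<and> proper_enumeration v \<and> Some i \<notin> range v}"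

end

theory Submission
  imports Defs
begin

text \<open>
  An instance \<open>h\<close> of the \<open>n\<close>-th jump of a problem stands for an instance \<open>g\<close> of the problem itself
  that is uniformly computable from the \<open>n\<close>-th Turing jump of \<open>h\<close>; conversely, everything uniformly
  computable from the \<open>n\<close>-th Turing jump of \<open>f\<close> is represented by an instance computable from \<open>f\<close>.
  If \<open>h\<close> represents an enumeration \<open>g\<close>, then \<open>h\<close> is also an instance of \<open>TJ\<^sup>(\<^sup>n\<^sup>)\<close>, with solution \<open>g'\<close>,
  which decides the range of \<open>g\<close>, so that the least number outside it can be found.
  In the other direction, the number sought is the result of a computation with oracle \<open>g'\<close>. Finite
  certificates of that computation can only be refuted by a later convergence of \<open>g\<close>-computations
  assumed to diverge, so the correct ones form a nonempty set that is co-enumerable relative to \<open>g\<close>;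
  choice finds one of them, and the number is read off from it.
\<close>

section \<open>Computable functions relative to an oracle\<close>

abbreviation pair :: "nat \<Rightarrow> nat \<Rightarrow> nat" where "pair a b \<equiv> prod_encode (a, b)"
abbreviation pfst :: "nat \<Rightarrow> nat" where "pfst z \<equiv> fst (prod_decode z)"
abbreviation psnd :: "nat \<Rightarrow> nat" where "psnd z \<equiv> snd (prod_decode z)"

text \<open>Convergence for every oracle and every input lets the closure rules be chained with
  hardly any side conditions on termination; partial programs come from unbounded search.\<close>

definition computable :: "(baire \<Rightarrow> nat \<Rightarrow> nat) \<Rightarrow> bool" where
  "computable F \<longleftrightarrow> (\<exists>p. \<forall>f x. run f p x = Some (F f x))"

definition decidable :: "(baire \<Rightarrow> nat \<Rightarrow> bool) \<Rightarrow> bool" where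
  "decidable R \<longleftrightarrow> computable (\<lambda>f x. of_bool (R f x))"

named_theorems comp_intros

lemma computable_id [comp_intros]: "computable (\<lambda>f x. x)"
  \<comment> \<open>No primitive is the identity, but re-pairing the two projections of
    \<open>x\<close> returns \<open>x\<close>.\<close>
  unfolding computable_def by (rule exI[of _ "Pair Fst Snd"]) simp

lemma computable_comp:
  assumes "computable A" "computable B"
  shows "computable (\<lambda>f x. A f (B f x))"
proof -
  obtain p q where "\<forall>f x. run f p x = Some (A f x)" "\<forall>f x. run f q x = Some (B f x)"
    using assms unfolding computable_def by blast
  then show ?thesis unfolding computable_def by (intro exI[of _ "Comp p q"]) simp
qed

lemma computable_pair [comp_intros]:
  assumes "computable A" "computable B"
  shows "computable (\<lambda>f x. pair (A f x) (B f x))"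
proof -
  obtain p q where "\<forall>f x. run f p x = Some (A f x)" "\<forall>f x. run f q x = Some (B f x)"
    using assms unfolding computable_def by blast
  then show ?thesis unfolding computable_def by (intro exI[of _ "Pair p q"]) simp
qed

lemma computable_Suc [comp_intros]: "computable A \<Longrightarrow> computable (\<lambda>f x. Suc (A f x))"
  by (rule computable_comp[of "\<lambda>f x. Suc x"])
    (auto simp: computable_def intro: exI[of _ Succ])

lemma computable_pfst [comp_intros]: "computable A \<Longrightarrow> computable (\<lambda>f x. pfst (A f x))"
  by (rule computable_comp[of "\<lambda>f x. pfst x"])
    (auto simp: computable_def intro: exI[of _ Fst])

lemma computable_psnd [comp_intros]: "computable A \<Longrightarrow> computable (\<lambda>f x. psnd (A f x))"
  by (rule computable_comp[of "\<lambda>f x. psnd x"])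
    (auto simp: computable_def intro: exI[of _ Snd])

lemma computable_query [comp_intros]: "computable A \<Longrightarrow> computable (\<lambda>f x. f (A f x))"
  by (rule computable_comp[of "\<lambda>f x. f x"])
    (auto simp: computable_def intro: exI[of _ Query])

lemma computable_const [comp_intros]: "computable (\<lambda>f x. c)"
proof (induction c)
  case 0
  show ?case unfolding computable_def by (rule exI[of _ Zero]) simp
qed (rule computable_Suc)

text \<open>The third premise packs parameter, counter and previous value into one number in the
  layout that \<open>PrimRec\<close> passes on, so that the step function remains unary.\<close>

lemma computable_rec_nat [comp_intros]:
  assumes "computable A" "computable N"
    and "computable (\<lambda>f z. G f (pfst z) (pfst (psnd z)) (psnd (psnd z)))"
  shows "computable (\<lambda>f x. rec_nat (A f x) (\<lambda>m r. G f x m r) (N f x))"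
proof -
  obtain p q where p: "run f p x = Some (A f x)"
    and q: "run f q z = Some (G f (pfst z) (pfst (psnd z)) (psnd (psnd z)))" for f x z
    using assms unfolding computable_def by blast
  have "rec_nat (run f p a)
      (\<lambda>m r. Option.bind r (\<lambda>y. run f q (prod_encode (a, prod_encode (m, y))))) n =
      Some (rec_nat (A f a) (\<lambda>m r. G f a m r) n)" for f a n
    by (induction n) (simp_all add: p q)
  then have "computable (\<lambda>f z. rec_nat (A f (pfst z)) (\<lambda>m r. G f (pfst z) m r) (psnd z))"
    unfolding computable_def
    by (intro exI[of _ "PrimRec p q"]) (simp add: case_prod_beta)
  from computable_comp[OF this computable_pair[OF computable_id assms(2)]] show ?thesis by simp
qed

lemma computable_pred: "computable A \<Longrightarrow> computable (\<lambda>f x. A f x - 1)"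
proof -
  have *: "rec_nat 0 (\<lambda>m r. m) n = n - 1" for n :: nat by (cases n) auto
  have "computable (\<lambda>f x. rec_nat 0 (\<lambda>m r. m) (A f x))" if "computable A"
    using that by (intro comp_intros)
  then show "computable A \<Longrightarrow> computable (\<lambda>f x. A f x - 1)" by (simp only: *)
qed

lemma computable_add [comp_intros]:
  assumes "computable A" "computable B" shows "computable (\<lambda>f x. A f x + B f x)"
proof -
  have *: "rec_nat a (\<lambda>m r. Suc r) b = a + b" for a b :: nat by (induction b) auto
  have "computable (\<lambda>f x. rec_nat (A f x) (\<lambda>m r. Suc r) (B f x))"
    by (intro comp_intros assms)
  then show ?thesis by (simp only: *)
qed

lemma computable_diff [comp_intros]:
  assumes "computable A" "computable B" shows "computable (\<lambda>f x. A f x - B f x)"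
proof -
  have *: "rec_nat a (\<lambda>m r. r - 1) b = a - b" for a b :: nat by (induction b) auto
  have "computable (\<lambda>f x. rec_nat (A f x) (\<lambda>m r. r - 1) (B f x))"
    by (intro comp_intros assms computable_pred)
  then show ?thesis by (simp only: *)
qed

lemma computable_mult [comp_intros]:
  assumes "computable A" "computable B" shows "computable (\<lambda>f x. A f x * B f x)"
proof -
  have *: "rec_nat 0 (\<lambda>m r. r + a) b = a * b" for a b :: nat by (induction b) auto
  have "computable (\<lambda>f x. rec_nat 0 (\<lambda>m r. r + A f x) (B f x))"
    by (intro comp_intros computable_comp[OF assms(1)] assms)
  then show ?thesis by (simp only: *)
qed

section \<open>Decidable relations and bounded quantifiers\<close>

lemma computable_of_bool: "decidable R \<Longrightarrow> computable (\<lambda>f x. of_bool (R f x))"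
  by (simp add: decidable_def)

lemma decidable_comp:
  assumes "decidable R" "computable A" shows "decidable (\<lambda>f x. R f (A f x))"
  using assms unfolding decidable_def by (rule computable_comp)

lemma decidable_comp2:
  assumes "decidable (\<lambda>f z. R f (pfst z) (psnd z))" "computable A" "computable B"
  shows "decidable (\<lambda>f x. R f (A f x) (B f x))"
  using decidable_comp[OF assms(1) computable_pair[OF assms(2,3)]] by simp

lemma decidable_const [comp_intros]: "decidable (\<lambda>f x. c)"
  unfolding decidable_def by (rule computable_const)

lemma decidable_less [comp_intros]:
  assumes "computable A" "computable B" shows "decidable (\<lambda>f x. A f x < B f x)"
proof -
  have *: "1 - (1 - (b - a)) = of_bool (a < b)" for a b :: nat by auto
  have "computable (\<lambda>f x. 1 - (1 - (B f x - A f x)))" by (intro comp_intros assms)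
  then show ?thesis unfolding decidable_def * .
qed

lemma decidable_not [comp_intros]:
  assumes "decidable R" shows "decidable (\<lambda>f x. \<not> R f x)"
proof -
  have *: "1 - of_bool b = (of_bool (\<not> b) :: nat)" for b by auto
  have "computable (\<lambda>f x. 1 - of_bool (R f x))"
    by (intro comp_intros computable_of_bool assms)
  then show ?thesis unfolding decidable_def * .
qed

lemma decidable_conj [comp_intros]:
  assumes "decidable R" "decidable S" shows "decidable (\<lambda>f x. R f x \<and> S f x)"
proof -
  have "computable (\<lambda>f x. of_bool (R f x) * of_bool (S f x))"
    by (intro computable_mult computable_of_bool assms)
  then show ?thesis by (simp only: decidable_def of_bool_conj)
qed

lemma decidable_disj [comp_intros]:
  assumes "decidable R" "decidable S" shows "decidable (\<lambda>f x. R f x \<or> S f x)"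
  using decidable_not[OF decidable_conj[OF decidable_not decidable_not, OF assms]] by simp

lemma decidable_imp [comp_intros]:
  assumes "decidable R" "decidable S" shows "decidable (\<lambda>f x. R f x \<longrightarrow> S f x)"
  unfolding imp_conv_disj by (rule decidable_disj[OF decidable_not[OF assms(1)] assms(2)])

lemma decidable_le [comp_intros]:
  assumes "computable A" "computable B" shows "decidable (\<lambda>f x. A f x \<le> B f x)"
  using decidable_not[OF decidable_less[OF assms(2,1)]] by (simp add: not_less)

lemma decidable_eq [comp_intros]:
  assumes "computable A" "computable B" shows "decidable (\<lambda>f x. A f x = B f x)"
  unfolding order_eq_iff
  by (rule decidable_conj[OF decidable_le[OF assms] decidable_le[OF assms(2,1)]])

lemma computable_if [comp_intros]:
  assumes "decidable R" "computable A" "computable B"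
  shows "computable (\<lambda>f x. if R f x then A f x else B f x)"
proof -
  have *: "of_bool r * a + (1 - of_bool r) * b = (if r then a else b)" for r and a b :: nat
    by auto
  have "computable (\<lambda>f x. of_bool (R f x) * A f x + (1 - of_bool (R f x)) * B f x)"
    by (intro comp_intros computable_of_bool assms)
  then show ?thesis unfolding * .
qed

lemma decidable_if [comp_intros]:
  assumes "decidable R" "decidable S" "decidable T"
  shows "decidable (\<lambda>f x. if R f x then S f x else T f x)"
proof -
  have "decidable (\<lambda>f x. (R f x \<longrightarrow> S f x) \<and> (\<not> R f x \<longrightarrow> T f x))"
    by (intro comp_intros assms)
  then show ?thesis by (simp add: if_bool_eq_conj)
qed

lemma decidable_ex [comp_intros]:
  assumes "computable N" "decidable (\<lambda>f z. R f (pfst z) (psnd z))"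
  shows "decidable (\<lambda>f x. \<exists>j<N f x. R f x j)"
proof -
  have *: "rec_nat 0 (\<lambda>m r. if P m then 1 else r) n = (of_bool (\<exists>j<n. P j) :: nat)" for P n
    by (induction n) (auto simp: less_Suc_eq)
  have R: "computable A \<Longrightarrow> computable B \<Longrightarrow> decidable (\<lambda>f x. R f (A f x) (B f x))" for A B
    using assms(2) by (rule decidable_comp2)
  have "computable (\<lambda>f x. rec_nat 0 (\<lambda>m r. if R f x m then 1 else r) (N f x))"
    by (intro comp_intros assms(1) R)
  then show ?thesis unfolding decidable_def * .
qed

lemma decidable_all [comp_intros]:
  assumes "computable N" "decidable (\<lambda>f z. R f (pfst z) (psnd z))"
  shows "decidable (\<lambda>f x. \<forall>j<N f x. R f x j)"
  using decidable_not[OF decidable_ex[OF assms(1) decidable_not[OF assms(2)]]] by simp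

text \<open>\<open>Mu\<close> looks for a first zero, so it is applied to the characteristic
  function of the negation. That function is total, hence no earlier test can block the
  search.\<close>

lemma search_program:
  assumes "decidable (\<lambda>f z. R f (pfst z) (psnd z))"
  obtains p where
    "\<And>f x. run f p x = (if \<exists>n. R f x n then Some (LEAST n. R f x n) else None)"
proof -
  have "computable (\<lambda>f z. of_bool (\<not> R f (pfst z) (psnd z)))"
    by (intro computable_of_bool comp_intros assms)
  then obtain p where "run f p z = Some (of_bool (\<not> R f (pfst z) (psnd z)))" for f z
    unfolding computable_def by blast
  then have "run f (Mu p) x = (if \<exists>n. R f x n then Some (LEAST n. R f x n) else None)" for f x
    by simp
  then show thesis by (rule that)
qed

lemma computable_Least [comp_intros]:
  assumes "decidable (\<lambda>f z. R f (pfst z) (psnd z))" "\<And>f x. \<exists>n. R f x n"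
  shows "computable (\<lambda>f x. LEAST n. R f x n)"
proof -
  obtain p where "run f p x = (if \<exists>n. R f x n then Some (LEAST n. R f x n) else None)" for f x
    using search_program[OF assms(1)] by blast
  then show ?thesis unfolding computable_def using assms(2) by auto
qed

lemma computable_div [comp_intros]:
  assumes "computable A" shows "computable (\<lambda>f x. A f x div numeral k)"
proof -
  have *: "(LEAST n. a < numeral k * Suc n) = a div numeral k" for a
  proof (rule Least_equality)
    show "a < numeral k * Suc (a div numeral k)"
      using dividend_less_times_div[of "numeral k" a] by simp
    show "a div numeral k \<le> n" if "a < numeral k * Suc n" for n
      using that by (metis less_Suc_eq_le less_mult_imp_div_less mult.commute)
  qed
  have ex: "\<exists>n. A f x < numeral k * Suc n" for f x
    by (rule exI[of _ "A f x"]) (use mult_le_mono1[of 1 "numeral k" "Suc (A f x)"] in simp)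
  have "computable (\<lambda>f x. LEAST n. A f x < numeral k * Suc n)"
    by (intro comp_intros computable_comp[OF assms(1)] ex)
  then show ?thesis unfolding * .
qed

lemma computable_mod [comp_intros]:
  assumes "computable A" shows "computable (\<lambda>f x. A f x mod numeral k)"
proof -
  have "computable (\<lambda>f x. A f x - numeral k * (A f x div numeral k))"
    by (intro comp_intros assms)
  then show ?thesis by (simp only: minus_mult_div_eq_mod)
qed

lemma decidable_even [comp_intros]:
  assumes "computable A" shows "decidable (\<lambda>f x. even (A f x))"
proof -
  have "decidable (\<lambda>f x. A f x mod 2 = 0)" by (intro comp_intros assms)
  then show ?thesis by (simp only: even_iff_mod_2_eq_zero)
qed

section \<open>Certificates of computations and the universal functional\<close>

text \<open>The fact \<open>fact_code e x y\<close> claims that program \<open>e\<close> maps \<open>x\<close> to \<open>y\<close>. A fact is justified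
  by a set of facts if it is a correct last step of a derivation; oracle answers are not checked here.\<close>

abbreviation fact_code :: "nat \<Rightarrow> nat \<Rightarrow> nat \<Rightarrow> nat" where
  "fact_code e x y \<equiv> pair e (pair x y)"

definition justified :: "nat list \<Rightarrow> nat \<Rightarrow> nat \<Rightarrow> nat \<Rightarrow> bool" where
  "justified L e x y \<longleftrightarrow>
    (if e = 0 then y = 0
     else if e = 1 then y = Suc x
     else if e = 2 then y = pfst x
     else if e = 3 then y = psnd x
     else if e = 4 then True
     else let k = (e - 5) div 4; a = pfst k; b = psnd k in
       if (e - 5) mod 4 = 0 then
         fact_code a x (pfst y) \<in> set L \<and> fact_code b x (psnd y) \<in> set L
       else if (e - 5) mod 4 = 1 then
         \<exists>u. fact_code b x u \<in> set L \<and> fact_code a u y \<in> set L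
       else if (e - 5) mod 4 = 2 then
         if psnd x = 0 then fact_code a (pfst x) y \<in> set L
         else \<exists>r. fact_code e (pair (pfst x) (psnd x - 1)) r \<in> set L \<and>
           fact_code b (pair (pfst x) (pair (psnd x - 1) r)) y \<in> set L
       else fact_code k (pair x y) 0 \<in> set L \<and>
         (\<forall>m<y. \<exists>r. fact_code k (pair x m) (Suc r) \<in> set L))"

text \<open>Together with \<open>prog_of_compound\<close> this gives derivation rules and syntax the
  same case distinction on \<open>r\<close>, so that soundness and completeness can compare them
  constructor by constructor.\<close>

lemma justified_compound:
  assumes "e \<ge> 5" "k = (e - 5) div 4" "r = (e - 5) mod 4"
  shows "justified L e x y \<longleftrightarrow>
      (if r = 0 then
         fact_code (pfst k) x (pfst y) \<in> set L \<and> fact_code (psnd k) x (psnd y) \<in> set L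
       else if r = 1 then
         \<exists>u. fact_code (psnd k) x u \<in> set L \<and> fact_code (pfst k) u y \<in> set L
       else if r = 2 then
         if psnd x = 0 then fact_code (pfst k) (pfst x) y \<in> set L
         else \<exists>r. fact_code e (pair (pfst x) (psnd x - 1)) r \<in> set L \<and>
           fact_code (psnd k) (pair (pfst x) (pair (psnd x - 1) r)) y \<in> set L
       else fact_code k (pair x y) 0 \<in> set L \<and>
         (\<forall>m<y. \<exists>r. fact_code k (pair x m) (Suc r) \<in> set L))"
  using assms(1) by (simp add: justified_def Let_def assms(2,3))

lemma prog_of_compound:
  assumes "e \<ge> 5" "k = (e - 5) div 4" "r = (e - 5) mod 4"
  shows "prog_of e =
      (if r = 0 then Pair (prog_of (pfst k)) (prog_of (psnd k))
        else if r = 1 then Comp (prog_of (pfst k)) (prog_of (psnd k))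
        else if r = 2 then PrimRec (prog_of (pfst k)) (prog_of (psnd k))
        else Mu (prog_of k))"
  using assms(1) by (subst prog_of.simps) (simp add: Let_def assms(2,3))

text \<open>The newest fact stands at the head and may appeal only to the tail, which excludes
  circular justification.\<close>

primrec derivation :: "nat list \<Rightarrow> bool" where
  "derivation [] = True"
| "derivation (t # L) = (derivation L \<and> justified L (pfst t) (pfst (psnd t)) (psnd (psnd t)))"

text \<open>Index 4 is \<open>Query\<close>. With the oracle kept out of \<open>derivation\<close>,
  a computation makes only finitely many claims about \<open>f\<close>; these are what is later
  guessed and refuted.\<close>

definition queries_correct :: "baire \<Rightarrow> nat list \<Rightarrow> bool" where
  "queries_correct f L \<longleftrightarrow> (\<forall>q a. fact_code 4 q a \<in> set L \<longrightarrow> f q = a)"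

lemma derivation_sound:
  assumes "derivation L" "queries_correct f L" "fact_code e x y \<in> set L"
  shows "run f (prog_of e) x = Some y"
  using assms
proof (induction L arbitrary: e x y)
  case (Cons t L)
  have L: "run f (prog_of e) x = Some y" if "fact_code e x y \<in> set L" for e x y
    using Cons that by (auto simp: queries_correct_def)
  show ?case
  proof (cases "fact_code e x y \<in> set L")
    case False
    then have t: "t = fact_code e x y" and j: "justified L e x y"
      using Cons.prems by auto
    define k where "k = (e - 5) div 4"
    define r where "r = (e - 5) mod 4"
    have r4: "r < 4" by (simp add: r_def)
    consider "e = 0" | "e = 1" | "e = 2" | "e = 3" | "e = 4" | "e \<ge> 5" by linarith
    then show ?thesis
    proof cases
      case 5
      then show ?thesis
        using Cons.prems t by (simp add: queries_correct_def prog_of.simps)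
    next
      case 6
      note p = prog_of_compound[OF 6 k_def r_def]
      have j: "(if r = 0 then
         fact_code (pfst k) x (pfst y) \<in> set L \<and> fact_code (psnd k) x (psnd y) \<in> set L
       else if r = 1 then
         \<exists>u. fact_code (psnd k) x u \<in> set L \<and> fact_code (pfst k) u y \<in> set L
       else if r = 2 then
         if psnd x = 0 then fact_code (pfst k) (pfst x) y \<in> set L
         else \<exists>r. fact_code e (pair (pfst x) (psnd x - 1)) r \<in> set L \<and>
           fact_code (psnd k) (pair (pfst x) (pair (psnd x - 1) r)) y \<in> set L
       else fact_code k (pair x y) 0 \<in> set L \<and>
         (\<forall>m<y. \<exists>r. fact_code k (pair x m) (Suc r) \<in> set L))"
        using j by (simp only: justified_compound[OF 6 k_def r_def])
      consider "r = 0" | "r = 1" | "r = 2" | "r = 3" using r4 by linarith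
      then show ?thesis
      proof cases
        case 1
        then show ?thesis using j p by (auto dest!: L)
      next
        case 2
        then show ?thesis using j p by (auto dest!: L)
      next
        case 3
        show ?thesis
        proof (cases "psnd x")
          case 0
          then show ?thesis using 3 j p by (auto dest!: L simp: case_prod_beta)
        next
          case (Suc n)
          then obtain s where
            "run f (prog_of e) (pair (pfst x) n) = Some s"
            "run f (prog_of (psnd k)) (pair (pfst x) (pair n s)) = Some y"
            using 3 j by (auto dest!: L)
          then show ?thesis using 3 p Suc by (simp add: case_prod_beta)
        qed
      next
        case 4
        \<comment> \<open>The listed values below \<open>y\<close> are all positive, which gives
          both convergence of the earlier tests and minimality of \<open>y\<close>.\<close>
        then have z: "run f (prog_of k) (pair x y) = Some 0"
          and s: "\<And>m. m < y \<Longrightarrow> \<exists>r. run f (prog_of k) (pair x m) = Some (Suc r)"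
          using j by (auto dest: L)
        have "(LEAST n. run f (prog_of k) (pair x n) = Some 0) = y"
          using z s by (intro Least_equality) (force simp: not_less[symmetric])+
        moreover have "\<exists>n. run f (prog_of k) (pair x n) = Some 0 \<and>
            (\<forall>m<n. run f (prog_of k) (pair x m) \<noteq> None)"
          using z s by (intro exI[of _ y]) force
        ultimately show ?thesis using 4 p by simp
      qed
    qed (use j in \<open>simp_all add: justified_def prog_of.simps\<close>)
  qed (rule L)
qed simp

text \<open>Membership in the list occurs only positively in \<open>justified\<close>. This is what
  allows derivations to be concatenated.\<close>

lemma justified_mono:
  "justified L e x y \<Longrightarrow> set L \<subseteq> set M \<Longrightarrow> justified M e x y"
  unfolding justified_def Let_def by (simp split: if_splits) (blast | meson subsetD)+

lemma derivation_append: "derivation L \<Longrightarrow> derivation M \<Longrightarrow> derivation (L @ M)"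
  by (induction L) (auto intro: justified_mono)

definition derivable :: "baire \<Rightarrow> nat \<Rightarrow> nat \<Rightarrow> nat \<Rightarrow> bool" where
  "derivable f e x y \<longleftrightarrow>
    (\<exists>L. derivation L \<and> queries_correct f L \<and> fact_code e x y \<in> set L)"

text \<open>Rules with several premises need one common derivation; a \<open>Mu\<close> step even
  has a premise for each tested number. Concatenation merges the separate derivations.\<close>

lemma derivable_finite:
  assumes "finite I" "\<And>i. i \<in> I \<Longrightarrow> derivable f (E i) (X i) (Y i)"
  shows "\<exists>L. derivation L \<and> queries_correct f L \<and>
    (\<forall>i\<in>I. fact_code (E i) (X i) (Y i) \<in> set L)"
  using assms
proof (induction I rule: finite_induct)
  case empty
  show ?case by (rule exI[of _ "[]"]) (simp add: queries_correct_def)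
next
  case (insert i I)
  then obtain L where "derivation L" "queries_correct f L"
    "\<forall>i\<in>I. fact_code (E i) (X i) (Y i) \<in> set L"
    by auto
  moreover obtain M where
    "derivation M" "queries_correct f M" "fact_code (E i) (X i) (Y i) \<in> set M"
    using insert.prems[of i] by (auto simp: derivable_def)
  ultimately show ?case
    by (intro exI[of _ "L @ M"]) (auto simp: queries_correct_def derivation_append)
qed

lemma derivable_step:
  assumes "derivation L" "queries_correct f L" "justified L e x y" "e = 4 \<Longrightarrow> f x = y"
  shows "derivable f e x y"
  unfolding derivable_def
  using assms by (intro exI[of _ "fact_code e x y # L"]) (auto simp: queries_correct_def)

text \<open>Induction on the index works because immediate subprograms have smaller indices.\<close>

lemma derivable_complete: "run f (prog_of e) x = Some y \<Longrightarrow> derivable f e x y"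
proof (induction e arbitrary: x y rule: less_induct)
  case (less e)
  define k where "k = (e - 5) div 4"
  define r where "r = (e - 5) mod 4"
  have r4: "r < 4" by (simp add: r_def)
  have nil: "derivation []" "queries_correct f []" by (simp_all add: queries_correct_def)
  consider "e = 0" | "e = 1" | "e = 2" | "e = 3" | "e = 4" | "e \<ge> 5" by linarith
  then show ?case
  proof cases
    case 6
    have k: "k < e" using 6 by (simp add: k_def)
    have a: "pfst k < e" "psnd k < e"
      using k fst_prod_decode_le snd_prod_decode_le by (meson le_less_trans)+
    note j = justified_compound[OF 6 k_def r_def] and p = prog_of_compound[OF 6 k_def r_def]
    have two: "\<exists>L. derivation L \<and> queries_correct f L \<and>
        fact_code e1 x1 y1 \<in> set L \<and> fact_code e2 x2 y2 \<in> set L"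
      if "derivable f e1 x1 y1" "derivable f e2 x2 y2" for e1 x1 y1 e2 x2 y2
    proof -
      have "\<exists>L. derivation L \<and> queries_correct f L \<and> (\<forall>i\<in>{(e1, x1, y1), (e2, x2, y2)}.
          fact_code (fst i) (fst (snd i)) (snd (snd i)) \<in> set L)"
        using that by (intro derivable_finite) auto
      then show ?thesis by simp
    qed
    consider "r = 0" | "r = 1" | "r = 2" | "r = 3" using r4 by linarith
    then show ?thesis
    proof cases
      case 1
      then have "run f (prog_of (pfst k)) x = Some (pfst y)"
        "run f (prog_of (psnd k)) x = Some (psnd y)"
        using less.prems p by (auto split: bind_splits)
      then have "derivable f (pfst k) x (pfst y)" "derivable f (psnd k) x (psnd y)"
        by (simp_all add: less.IH a)
      from two[OF this] show ?thesis
        using derivable_step[of _ f e x y] j[of _ x y] 1 6 by auto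
    next
      case 2
      then obtain u where "run f (prog_of (psnd k)) x = Some u"
        "run f (prog_of (pfst k)) u = Some y"
        using less.prems p by (auto split: bind_splits)
      then have "derivable f (psnd k) x u" "derivable f (pfst k) u y"
        by (simp_all add: less.IH a)
      from two[OF this] show ?thesis
        using derivable_step[of _ f e x y] j[of _ x y] 2 6 by auto
    next
      case 3
      \<comment> \<open>A primitive recursion refers back to its own index, out of reach of the
        outer hypothesis, so the counter carries a second induction.\<close>
      have "derivable f e (pair c n) y" if "run f (prog_of e) (pair c n) = Some y" for c n y
        using that
      proof (induction n arbitrary: y)
        case 0
        then have "run f (prog_of (pfst k)) c = Some y"
          using p 3 by simp
        then have "derivable f (pfst k) c y" by (rule less.IH[OF a(1)])
        from two[OF this this] show ?case
          using derivable_step[of _ f e "pair c 0" y] j[of _ "pair c 0" y] 3 6 by auto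
      next
        case (Suc n)
        then obtain s where "run f (prog_of e) (pair c n) = Some s"
          "run f (prog_of (psnd k)) (pair c (pair n s)) = Some y"
          using p 3 by (auto split: bind_splits)
        then have "derivable f e (pair c n) s" "derivable f (psnd k) (pair c (pair n s)) y"
          by (simp_all add: Suc.IH less.IH a)
        from two[OF this] show ?case
          using derivable_step[of _ f e "pair c (Suc n)" y] j[of _ "pair c (Suc n)" y] 3 6
          by auto
      qed
      from this[of "pfst x" "psnd x" y] show ?thesis using less.prems by simp
    next
      case 4
      define P where "P n \<longleftrightarrow> run f (prog_of k) (pair x n) = Some 0" for n
      have ex: "\<exists>n. P n \<and> (\<forall>m<n. run f (prog_of k) (pair x m) \<noteq> None)"
        and y: "y = (LEAST n. P n)"
        using less.prems p 4 by (auto simp: P_def split: if_splits)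
      have Py: "P y" using ex y LeastI[of P] by metis
      have "\<exists>s. run f (prog_of k) (pair x m) = Some (Suc s)" if "m < y" for m
      proof -
        from ex obtain n where n: "P n" "\<forall>m<n. run f (prog_of k) (pair x m) \<noteq> None" by blast
        then have "y \<le> n" using y Least_le[of P] by simp
        then obtain s where s: "run f (prog_of k) (pair x m) = Some s"
          using n(2) \<open>m < y\<close> by force
        have "s \<noteq> 0" using \<open>m < y\<close> y s not_less_Least[of m P] by (auto simp: P_def)
        then show ?thesis using s by (cases s) auto
      qed
      then obtain s where s: "\<And>m. m < y \<Longrightarrow> run f (prog_of k) (pair x m) = Some (Suc (s m))"
        by metis
      have "derivable f k (pair x m) (if m = y then 0 else Suc (s m))" if "m \<in> {..y}" for m
        using that Py s[of m] by (intro less.IH[OF k]) (auto simp: P_def)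
      then have "\<exists>L. derivation L \<and> queries_correct f L \<and>
          (\<forall>m\<in>{..y}. fact_code k (pair x m) (if m = y then 0 else Suc (s m)) \<in> set L)"
        by (intro derivable_finite) auto
      then obtain L where L: "derivation L" "queries_correct f L"
        "\<forall>m\<in>{..y}. fact_code k (pair x m) (if m = y then 0 else Suc (s m)) \<in> set L"
        by blast
      have "fact_code k (pair x y) 0 \<in> set L"
        using bspec[OF L(3), of y] by simp
      moreover have "\<exists>r. fact_code k (pair x m) (Suc r) \<in> set L" if "m < y" for m
        using L(3)[rule_format, of m] that by (intro exI[of _ "s m"]) simp
      ultimately have "justified L e x y" using j[of L x y] 4 by simp
      with L show ?thesis using 6 by (intro derivable_step) auto
    qed
  qed (use less.prems in \<open>auto simp: prog_of.simps justified_def intro!: derivable_step[OF nil]\<close>)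
qed

text \<open>Derivations are coded by \<open>list_encode\<close>, for which \<open>code_drop j\<close> removes the first \<open>j\<close> entries.\<close>

definition code_drop :: "nat \<Rightarrow> nat \<Rightarrow> nat" where
  "code_drop j c = rec_nat c (\<lambda>m r. psnd (r - 1)) j"

definition code_hd :: "nat \<Rightarrow> nat" where
  "code_hd c = pfst (c - 1)"

lemma code_drop_list_encode: "code_drop j (list_encode L) = list_encode (drop j L)"
proof (induction j)
  case (Suc j)
  \<comment> \<open>The empty list has code 0 and \<open>psnd 0 = 0\<close>, so dropping entries
    past the end stays at 0.\<close>
  have "psnd (list_encode M - 1) = list_encode (tl M)" for M
    by (cases M) (simp_all, simp add: prod_decode_def prod_decode_aux.simps)
  then show ?case using Suc by (simp add: code_drop_def drop_Suc tl_drop)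
qed (simp add: code_drop_def)

lemma length_le_list_encode: "length L \<le> list_encode L"
  by (induction L) (auto intro: order_trans[OF _ le_prod_encode_2])

lemma in_set_less_list_encode: "t \<in> set L \<Longrightarrow> t < list_encode L"
  by (induction L)
    (auto simp: less_Suc_eq_le le_prod_encode_1 intro: order_trans[OF less_imp_le le_prod_encode_2])

text \<open>Only the empty list has code 0, so a nonzero remainder means that position
  \<open>j\<close> exists; positions below \<open>c\<close> suffice because a list is no longer than
  its code.\<close>

lemma in_set_decode_iff:
  "t \<in> set (list_decode c) \<longleftrightarrow> (\<exists>j<c. code_drop j c \<noteq> 0 \<and> code_hd (code_drop j c) = t)"
proof -
  obtain L where c: "c = list_encode L" using list_decode_inverse by metis
  have e: "list_encode M \<noteq> 0 \<longleftrightarrow> M \<noteq> []" for M by (cases M) auto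
  have h: "code_hd (list_encode M) = hd M" if "M \<noteq> []" for M
    using that by (cases M) (auto simp: code_hd_def)
  have "(\<exists>j<c. code_drop j c \<noteq> 0 \<and> code_hd (code_drop j c) = t) \<longleftrightarrow>
      (\<exists>j<c. j < length L \<and> L ! j = t)"
  proof -
    have "code_drop j c \<noteq> 0 \<and> code_hd (code_drop j c) = t \<longleftrightarrow> j < length L \<and> L ! j = t" for j
    proof (cases "j < length L")
      case True
      then show ?thesis
        using e[of "drop j L"] h[of "drop j L"]
        by (simp add: c code_drop_list_encode hd_drop_conv_nth)
    next
      case False
      then show ?thesis by (simp add: c code_drop_list_encode)
    qed
    then show ?thesis by simp
  qed
  also have "\<dots> \<longleftrightarrow> t \<in> set L"
    using length_le_list_encode[of L] by (auto simp: c in_set_conv_nth intro: less_le_trans)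
  finally show ?thesis by (simp add: c)
qed

lemma computable_code_drop [comp_intros]:
  "computable A \<Longrightarrow> computable B \<Longrightarrow> computable (\<lambda>f x. code_drop (A f x) (B f x))"
  unfolding code_drop_def by (intro comp_intros)

lemma computable_code_hd [comp_intros]:
  "computable A \<Longrightarrow> computable (\<lambda>f x. code_hd (A f x))"
  unfolding code_hd_def by (intro comp_intros)

lemma decidable_in_set [comp_intros]:
  assumes "computable A" "computable B"
  shows "decidable (\<lambda>f x. A f x \<in> set (list_decode (B f x)))"
proof -
  have "decidable (\<lambda>f z. pfst z \<in> set (list_decode (psnd z)))"
    unfolding in_set_decode_iff by (intro comp_intros)
  from decidable_comp2[OF this assms] show ?thesis .
qed


text \<open>This bounds by the code \<open>c\<close> every quantifier over components of listed
  facts, which makes the conditions on coded derivations decidable.\<close>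

lemma in_set_decode_bound: "fact_code e x y \<in> set (list_decode c) \<Longrightarrow> e < c \<and> x < c \<and> y < c"
  using in_set_less_list_encode[of "fact_code e x y" "list_decode c"]
  by simp (meson le_less_trans le_prod_encode_1 le_prod_encode_2)

lemma decidable_justified:
  assumes "computable C" "computable E" "computable X" "computable Y"
  shows "decidable (\<lambda>f z. justified (list_decode (C f z)) (E f z) (X f z) (Y f z))"
proof -
  have bounds:
    "(\<exists>u. fact_code b x u \<in> set (list_decode c) \<and> Q u) \<longleftrightarrow>
      (\<exists>u<c. fact_code b x u \<in> set (list_decode c) \<and> Q u)"
    "(\<exists>u. fact_code b x (Suc u) \<in> set (list_decode c)) \<longleftrightarrow>
      (\<exists>u<c. fact_code b x (Suc u) \<in> set (list_decode c))" for b x c Q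
    by (blast dest: in_set_decode_bound Suc_lessD)+
  have "decidable (\<lambda>f z. justified (list_decode (pfst z)) (pfst (psnd z))
      (pfst (psnd (psnd z))) (psnd (psnd (psnd z))))"
    unfolding justified_def Let_def bounds by (intro comp_intros)
  from decidable_comp[OF this computable_pair[OF assms(1) computable_pair[OF assms(2)
    computable_pair[OF assms(3,4)]]]] show ?thesis by simp
qed

text \<open>Recursion on the list is traded for a bounded quantifier over positions, the form in
  which decidability can be shown.\<close>

lemma derivation_iff:
  "derivation L \<longleftrightarrow> (\<forall>j<length L.
    justified (drop (Suc j) L) (pfst (L ! j)) (pfst (psnd (L ! j))) (psnd (psnd (L ! j))))"
  by (induction L) (auto simp: All_less_Suc2)

lemma decidable_derivation [comp_intros]:
  assumes "computable C" shows "decidable (\<lambda>f z. derivation (list_decode (C f z)))"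
proof -
  have *: "derivation (list_decode c) \<longleftrightarrow> (\<forall>j<c. code_drop j c \<noteq> 0 \<longrightarrow>
      justified (list_decode (code_drop (Suc j) c)) (pfst (code_hd (code_drop j c)))
        (pfst (psnd (code_hd (code_drop j c)))) (psnd (psnd (code_hd (code_drop j c)))))" for c
  proof -
    obtain L where c: "c = list_encode L" using list_decode_inverse by metis
    have e: "code_drop j c \<noteq> 0 \<longleftrightarrow> j < length L" for j
    proof -
      have "list_encode M \<noteq> 0 \<longleftrightarrow> M \<noteq> []" for M by (cases M) auto
      then show ?thesis by (simp add: c code_drop_list_encode not_le)
    qed
    have h: "code_hd (code_drop j c) = L ! j" if "j < length L" for j
      using that unfolding c code_drop_list_encode
      by (cases "drop j L") (auto simp: code_hd_def hd_drop_conv_nth[symmetric])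
    show ?thesis
      unfolding e using length_le_list_encode[of L]
      by (auto simp: c derivation_iff h[unfolded c code_drop_list_encode] code_drop_list_encode
          intro: less_le_trans)
  qed
  have "decidable (\<lambda>f c. derivation (list_decode c))"
    unfolding * by (intro comp_intros decidable_justified)
  from decidable_comp[OF this assms] show ?thesis .
qed

text \<open>The output is packed with the derivation, so that a search for \<open>z\<close> also
  delivers the value.\<close>

definition certifies :: "baire \<Rightarrow> nat \<Rightarrow> nat \<Rightarrow> nat \<Rightarrow> bool" where
  "certifies f e x z \<longleftrightarrow> fact_code e x (pfst z) \<in> set (list_decode (psnd z)) \<and>
    derivation (list_decode (psnd z)) \<and> queries_correct f (list_decode (psnd z))"

lemma certifies_sound: "certifies f e x z \<Longrightarrow> run f (prog_of e) x = Some (pfst z)"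
  by (auto simp: certifies_def intro: derivation_sound)

lemma certifies_complete:
  assumes "run f (prog_of e) x = Some y" shows "\<exists>L. certifies f e x (pair y (list_encode L))"
  using derivable_complete[OF assms] by (simp add: derivable_def certifies_def) blast

lemma queries_correct_decode_iff:
  "queries_correct f (list_decode c) \<longleftrightarrow>
    (\<forall>q<c. \<forall>a<c. fact_code 4 q a \<in> set (list_decode c) \<longrightarrow> f q = a)"
  unfolding queries_correct_def by (blast dest: in_set_decode_bound)

lemma decidable_certifies [comp_intros]:
  assumes "computable G" "computable E" "computable X" "computable Z"
  shows "decidable (\<lambda>f z. certifies (G f) (E f z) (X f z) (Z f z))"
proof -
  have "decidable (\<lambda>f z. certifies (G f) (pfst z) (pfst (psnd z)) (psnd (psnd z)))"
    unfolding certifies_def queries_correct_decode_iff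
    by (intro comp_intros computable_comp[OF assms(1)])
  from decidable_comp[OF this computable_pair[OF assms(2) computable_pair[OF assms(3,4)]]]
  show ?thesis by simp
qed

text \<open>The program searches for a certificate and returns its first component. Soundness makes
  any certificate found correct, and completeness ensures that the search fails only if the
  computation diverges.\<close>

lemma universal_program:
  assumes "computable G" "computable E" "computable X"
  obtains p where "\<And>f x. run f p x = run (G f) (prog_of (E f x)) (X f x)"
proof -
  have EX: "computable (\<lambda>f z. E f (pfst z))" "computable (\<lambda>f z. X f (pfst z))"
    by (intro computable_comp[OF assms(2)] computable_comp[OF assms(3)] comp_intros)+
  have "decidable (\<lambda>f z. certifies (G f) (E f (pfst z)) (X f (pfst z)) (psnd z))"
    by (intro comp_intros assms(1) EX)
  then obtain p where p: "run f p x = (if \<exists>z. certifies (G f) (E f x) (X f x) z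
      then Some (LEAST z. certifies (G f) (E f x) (X f x) z) else None)" for f x
    by (rule search_program) blast
  have "run f (Comp Fst p) x = run (G f) (prog_of (E f x)) (X f x)" for f x
  proof (cases "run (G f) (prog_of (E f x)) (X f x)")
    case None
    then have "\<not> certifies (G f) (E f x) (X f x) z" for z
      using certifies_sound by (metis option.distinct(1))
    then show ?thesis by (simp add: p None)
  next
    case (Some y)
    then have ex: "\<exists>z. certifies (G f) (E f x) (X f x) z"
      using certifies_complete by blast
    from certifies_sound[OF LeastI_ex[OF this]] ex show ?thesis by (simp add: p)
  qed
  then show thesis by (rule that)
qed

section \<open>Uniformly computable relations and Turing jumps\<close>

definition transduces :: "prog \<Rightarrow> baire \<Rightarrow> baire \<Rightarrow> bool" where
  "transduces p f g \<longleftrightarrow> (\<forall>x. run f p x = Some (g x))"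

lemma maps_to_iff_transduces: "maps_to e f g \<longleftrightarrow> transduces (prog_of e) f g"
  by (simp add: maps_to_def transduces_def Phi_def)

lemma transduces_unique: "transduces p f g \<Longrightarrow> transduces p f h \<Longrightarrow> g = h"
  by (auto simp: transduces_def)

text \<open>A relation is used because the maps concerned are partial and often given through a
  preimage, as in \<open>F = turing_jump f\<close>; outside the relation the program may do
  anything.\<close>

definition uniformly_computable :: "(baire \<Rightarrow> baire \<Rightarrow> bool) \<Rightarrow> bool" where
  "uniformly_computable R \<longleftrightarrow> (\<exists>p. \<forall>f g. R f g \<longrightarrow> transduces p f g)"

lemma uniformly_computable_mono:
  "uniformly_computable S \<Longrightarrow> (\<And>f g. R f g \<Longrightarrow> S f g) \<Longrightarrow> uniformly_computable R"
  unfolding uniformly_computable_def by meson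

lemma uniformly_computable_index:
  assumes "uniformly_computable R" obtains e where "\<And>f g. R f g \<Longrightarrow> maps_to e f g"
  using assms surj_prog_of unfolding uniformly_computable_def maps_to_iff_transduces
  by (metis surjD)

lemma uniformly_computable_total:
  "computable G \<Longrightarrow> uniformly_computable (\<lambda>f g. g = G f)"
  by (auto simp: uniformly_computable_def computable_def transduces_def)

section \<open>Oracle substitution and closure properties\<close>

primrec subst_query :: "prog \<Rightarrow> prog \<Rightarrow> prog" where
  "subst_query q Zero = Zero"
| "subst_query q Succ = Succ"
| "subst_query q Fst = Fst"
| "subst_query q Snd = Snd"
| "subst_query q Query = q"
| "subst_query q (Pair p r) = Pair (subst_query q p) (subst_query q r)"
| "subst_query q (Comp p r) = Comp (subst_query q p) (subst_query q r)"
| "subst_query q (PrimRec p r) = PrimRec (subst_query q p) (subst_query q r)"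
| "subst_query q (Mu p) = Mu (subst_query q p)"

text \<open>The oracle enters only through \<open>Query\<close>. The equality is one of partial
  functions, so divergence is preserved too, as the treatment of the jump requires.\<close>

lemma run_subst_query: "transduces q f g \<Longrightarrow> run f (subst_query q p) = run g p"
  by (induction p) (rule ext, simp add: transduces_def)+

lemma uniformly_computable_comp:
  assumes "uniformly_computable R" "uniformly_computable S"
  shows "uniformly_computable (R OO S)"
proof -
  obtain p q where pq: "\<And>f g. R f g \<Longrightarrow> transduces p f g" "\<And>f g. S f g \<Longrightarrow> transduces q f g"
    using assms unfolding uniformly_computable_def by blast
  have "transduces (subst_query p q) f h" if "(R OO S) f h" for f h
  proof -
    from that obtain g where "transduces p f g" "transduces q g h" using pq by blast
    then show ?thesis by (simp add: transduces_def[of "subst_query p q"] run_subst_query)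
      (simp add: transduces_def)
  qed
  then show ?thesis unfolding uniformly_computable_def by blast
qed

lemma uniformly_computable_join:
  assumes "uniformly_computable R" "uniformly_computable S"
  shows "uniformly_computable (\<lambda>f k. \<exists>g h. k = turing_join g h \<and> R f g \<and> S f h)"
proof -
  obtain p q where pq: "\<And>f g. R f g \<Longrightarrow> transduces p f g" "\<And>f g. S f g \<Longrightarrow> transduces q f g"
    using assms unfolding uniformly_computable_def by blast
  have "computable (\<lambda>f x. x div 2)" by (intro comp_intros)
  then obtain d where d: "run f d x = Some (x div 2)" for f x
    unfolding computable_def by blast
  have "computable (\<lambda>f z. if even (pfst z) then pfst (psnd z) else psnd (psnd z))"
    by (intro comp_intros)
  then obtain s where
    s: "run f s z = Some (if even (pfst z) then pfst (psnd z) else psnd (psnd z))" for f z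
    unfolding computable_def by blast
  have "transduces (Comp s (Pair (Pair Fst Snd) (Pair (Comp p d) (Comp q d)))) f (turing_join g h)"
    if "R f g" "S f h" for f g h
    using pq(1)[OF that(1)] pq(2)[OF that(2)] by (simp add: transduces_def turing_join_def d s)
  then show ?thesis unfolding uniformly_computable_def by blast
qed

text \<open>The \<open>s\<close>-\<open>m\<close>-\<open>n\<close> theorem in the form needed here: \<open>t x\<close> is an index of the composition of \<open>q\<close>
  with a program for the constant \<open>x\<close>.\<close>

lemma halting_index:
  obtains t where "computable (\<lambda>_. t)"
    and "\<And>f x. turing_jump f (t x) = of_bool (run f q x \<noteq> None)"
proof -
  obtain a where a: "prog_of a = q" using surj_prog_of by (metis surjD)
  \<comment> \<open>Here 0 indexes \<open>Zero\<close>, 1 indexes \<open>Succ\<close>, and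
    \<open>5 + (4 * k + 1)\<close> indexes a composition, so \<open>c x\<close> is the
    \<open>x\<close>-fold successor of zero.\<close>
  define c where "c x = rec_nat 0 (\<lambda>m r. 5 + (4 * pair 1 r + 1)) x" for x
  define t where "t x = 5 + (4 * pair a (c x) + 1)" for x
  have comp: "prog_of (5 + (4 * pair u v + 1)) = Comp (prog_of u) (prog_of v)" for u v
  proof -
    have "(5 + (4 * pair u v + 1) - 5) div 4 = pair u v" "(5 + (4 * pair u v + 1) - 5) mod 4 = 1"
      by auto
    then show ?thesis by (subst prog_of.simps) (simp add: Let_def)
  qed
  have c: "run f (prog_of (c x)) y = Some x" for f x y
  proof (induction x)
    case 0
    show ?case by (simp add: c_def prog_of.simps)
  next
    case (Suc x)
    have "prog_of (c (Suc x)) = Comp Succ (prog_of (c x))"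
      using comp[of 1 "c x"] by (simp add: c_def prog_of.simps)
    then show ?case using Suc by simp
  qed
  have "computable (\<lambda>_. t)" unfolding t_def c_def by (intro comp_intros)
  moreover have "turing_jump f (t x) = of_bool (run f q x \<noteq> None)" for f x
  proof -
    \<comment> \<open>The jump runs program \<open>t x\<close> on its own index; the constant
      program discards that input.\<close>
    have "prog_of (t x) = Comp q (prog_of (c x))" unfolding t_def comp a ..
    then show ?thesis by (simp add: turing_jump_def Phi_def c)
  qed
  ultimately show thesis by (rule that)
qed

text \<open>If \<open>f\<close> computes \<open>g\<close>, then halting with oracle \<open>g\<close>
  is halting of a simulation with oracle \<open>f\<close>, whose index is found by \<open>t\<close>.
  So the jump of \<open>g\<close> is many-one reducible to that of \<open>f\<close>.\<close>

lemma uniformly_computable_turing_jump: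
  assumes "uniformly_computable R"
  shows "uniformly_computable
    (\<lambda>F G. \<exists>f g. F = turing_jump f \<and> G = turing_jump g \<and> R f g)"
proof -
  obtain p where p: "\<And>f g. R f g \<Longrightarrow> transduces p f g"
    using assms unfolding uniformly_computable_def by blast
  obtain v where v: "\<And>f x. run f v x = run f (prog_of x) x"
    by (rule universal_program[of "\<lambda>f x. f x" "\<lambda>f x. x" "\<lambda>f x. x"]) (intro comp_intros | blast)+
  obtain t where t: "computable (\<lambda>_. t)"
    "\<And>f x. turing_jump f (t x) = of_bool (run f (subst_query p v) x \<noteq> None)"
    by (rule halting_index) blast
  have "uniformly_computable (\<lambda>F G. G = (\<lambda>x. F (t x)))"
    by (intro uniformly_computable_total computable_query t(1))
  moreover have "turing_jump g = (\<lambda>x. turing_jump f (t x))" if "R f g" for f g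
    unfolding t(2) run_subst_query[OF p[OF that]] v
    by (auto simp: turing_jump_def Phi_def)
  ultimately show ?thesis by (elim uniformly_computable_mono) blast
qed

text \<open>The jump can answer whether \<open>f x = n\<close>; asking this for successive
  \<open>n\<close> recovers \<open>f x\<close>.\<close>

lemma uniformly_computable_from_turing_jump:
  "uniformly_computable (\<lambda>F f. F = turing_jump f)"
proof -
  \<comment> \<open>The condition ignores the search variable, so the search stops at once or
    never.\<close>
  have "decidable (\<lambda>f z. f (pfst (pfst z)) = psnd (pfst z))" by (intro comp_intros)
  then obtain q where
    q: "run f q z = (if \<exists>n::nat. f (pfst z) = psnd z then Some (LEAST n. f (pfst z) = psnd z) else None)"
    for f z by (rule search_program) blast
  obtain t where t: "computable (\<lambda>_. t)"
    "\<And>f x. turing_jump f (t x) = of_bool (run f q x \<noteq> None)"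
    by (rule halting_index) blast
  have "computable (\<lambda>f z. t (pair (pfst z) (psnd z)))"
    by (intro computable_comp[OF t(1)] comp_intros)
  then have "decidable (\<lambda>f z. f (t (pair (pfst z) (psnd z))) = 1)"
    by (intro comp_intros)
  then obtain p where p: "run F p x = (if \<exists>n. F (t (pair x n)) = 1
      then Some (LEAST n. F (t (pair x n)) = 1) else None)" for F x
    by (rule search_program) blast
  have "transduces p (turing_jump f) f" for f
  proof -
    have "turing_jump f (t (pair x n)) = 1 \<longleftrightarrow> n = f x" for x n
      by (auto simp: t(2) q)
    moreover have "(LEAST n. n = f x) = f x" for x by (rule Least_equality) auto
    ultimately show ?thesis by (simp add: transduces_def p)
  qed
  then show ?thesis by (auto simp: uniformly_computable_def)
qed

abbreviation iter_turing_jump :: "nat \<Rightarrow> baire \<Rightarrow> baire" where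
  "iter_turing_jump n \<equiv> turing_jump ^^ n"

text \<open>Splitting off the innermost jump matches \<open>represents\<close>, whose outermost
  layer uses one jump of its own oracle.\<close>

lemma iter_turing_jump_Suc: "iter_turing_jump (Suc n) f = iter_turing_jump n (turing_jump f)"
  by (simp only: funpow_Suc_right o_apply)

lemma uniformly_computable_iter_turing_jump:
  "uniformly_computable R \<Longrightarrow> uniformly_computable
    (\<lambda>F G. \<exists>f g. F = iter_turing_jump n f \<and> G = iter_turing_jump n g \<and> R f g)"
proof (induction n arbitrary: R)
  case 0
  then show ?case by simp
next
  case (Suc n)
  show ?case
    by (rule uniformly_computable_mono[OF Suc.IH[OF uniformly_computable_turing_jump[OF Suc.prems]]])
      (auto simp only: iter_turing_jump_Suc)
qed

lemma uniformly_computable_from_iter_turing_jump: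
  "uniformly_computable (\<lambda>F f. F = iter_turing_jump n f)"
proof (induction n)
  case 0
  have "uniformly_computable (\<lambda>f g. g = f)"
    by (rule uniformly_computable_total[OF computable_query[OF computable_id]])
  then show ?case by (elim uniformly_computable_mono) simp
next
  case (Suc n)
  from uniformly_computable_comp[OF this uniformly_computable_from_turing_jump] show ?case
    by (elim uniformly_computable_mono) (simp only: iter_turing_jump_Suc, blast)
qed

section \<open>Instances of iterated jumps of problems\<close>

lemma turing_join_even [simp]: "turing_join f g (2 * x) = f x"
  and turing_join_odd [simp]: "turing_join f g (Suc (2 * x)) = g x"
  by (simp_all add: turing_join_def)

lemma turing_join_inject [simp]: "turing_join f g = turing_join h k \<longleftrightarrow> f = h \<and> g = k"
  by (metis ext turing_join_even turing_join_odd)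

lemma emb_inject [simp]: "emb x = emb y \<longleftrightarrow> x = y"
  by (auto simp: emb_def fun_eq_iff split: if_splits)

text \<open>\<open>represents n h g\<close>: an instance \<open>h\<close> of the \<open>n\<close>-th jump of a problem stands for its instance \<open>g\<close>.\<close>

primrec represents :: "nat \<Rightarrow> baire \<Rightarrow> baire \<Rightarrow> bool" where
  "represents 0 h g \<longleftrightarrow> h = g"
| "represents (Suc n) h g \<longleftrightarrow>
    (\<exists>f i k. h = turing_join f (emb i) \<and> Delta2_index f i k \<and> represents n k g)"

lemma Delta2_index_unique: "Delta2_index f i g \<Longrightarrow> Delta2_index f i h \<Longrightarrow> g = h"
  by (auto simp: Delta2_index_def maps_to_iff_transduces intro: transduces_unique)

text \<open>An index relative to \<open>f\<close> determines at most one function, so the union in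
  the definition of \<open>jump\<close> has a single term.\<close>

lemma jump_eq:
  assumes "Delta2_index f i k" "k \<in> instances P"
  shows "jump P (turing_join f (emb i)) = P k"
proof
  show "P k \<subseteq> jump P (turing_join f (emb i))"
    using assms unfolding jump_def by blast
  show "jump P (turing_join f (emb i)) \<subseteq> P k"
  proof
    fix u assume "u \<in> jump P (turing_join f (emb i))"
    then obtain g where "Delta2_index f i g" "u \<in> P g"
      unfolding jump_def mem_Collect_eq turing_join_inject emb_inject by metis
    then show "u \<in> P k" using Delta2_index_unique[OF assms(1)] by simp
  qed
qed

lemma iter_jump_represents:
  "represents n h g \<Longrightarrow> g \<in> instances P \<Longrightarrow> iter_jump P n h = P g"
proof (induction n arbitrary: h)
  case 0
  then show ?case by (simp add: iter_jump_def)
next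
  case (Suc n)
  from Suc.prems(1) obtain f i k where h: "h = turing_join f (emb i)" "Delta2_index f i k"
    and k: "represents n k g"
    unfolding represents.simps by (elim exE conjE)
  have eq: "iter_jump P n k = P g" using k Suc.prems(2) by (rule Suc.IH)
  have "iter_jump P (Suc n) h = jump (iter_jump P n) h" by (simp add: iter_jump_def)
  also have "\<dots> = iter_jump P n k"
    using Suc.prems(2) by (simp only: h(1), intro jump_eq h(2)) (simp add: instances_def eq)
  finally show ?case by (simp only: eq)
qed

lemma instances_iter_jump:
  assumes "h \<in> instances (iter_jump P n)"
  shows "\<exists>g. represents n h g \<and> g \<in> instances P"
  using assms
proof (induction n arbitrary: h)
  case 0
  then show ?case by (simp add: iter_jump_def)
next
  case (Suc n)
  then have "jump (iter_jump P n) h \<noteq> {}" by (simp add: instances_def iter_jump_def)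
  then obtain u where "u \<in> jump (iter_jump P n) h" by blast
  then obtain f i k where h: "h = turing_join f (emb i)" "Delta2_index f i k"
    and k: "k \<in> instances (iter_jump P n)"
    unfolding jump_def mem_Collect_eq by (elim exE conjE)
  from Suc.IH[OF k] obtain g where "represents n k g" "g \<in> instances P" by blast
  with h have "represents (Suc n) h g" by (simp only: represents.simps) (intro exI conjI, rule refl)
  with \<open>g \<in> instances P\<close> show ?case by blast
qed

text \<open>The jump of \<langle>f, i\<rangle> computes \<open>i\<close> and the jump of
  \<open>f\<close>, hence the next layer \<open>k\<close>. Applying \<open>n\<close> further jumps
  to this step leads to the induction hypothesis for \<open>k\<close>.\<close>

lemma uniformly_computable_represented:
  "uniformly_computable (\<lambda>F g. \<exists>h. F = iter_turing_jump n h \<and> represents n h g)"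
proof (induction n)
  case 0
  have "uniformly_computable (\<lambda>F g. g = F)" by (rule uniformly_computable_total[OF computable_query[OF computable_id]])
  then show ?case by (rule uniformly_computable_mono) simp
next
  case (Suc n)
  let ?T = "\<lambda>F k. \<exists>f i. F = turing_jump (turing_join f (emb i)) \<and> Delta2_index f i k"
  have "uniformly_computable (\<lambda>F G. \<exists>f g. F = turing_jump f \<and> G = turing_jump g \<and> g = (\<lambda>x. f (2 * x)))"
    by (intro uniformly_computable_turing_jump uniformly_computable_total comp_intros)
  from uniformly_computable_join[OF this uniformly_computable_from_turing_jump]
  have join: "uniformly_computable (\<lambda>F G. \<exists>f. F = turing_jump f \<and>
      G = turing_join (turing_jump (\<lambda>x. f (2 * x))) f)"
    by (rule uniformly_computable_mono) blast
  \<comment> \<open>In the join of the jump of \<open>f\<close> with \<langle>f, i\<rangle>, the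
    number \<open>i\<close> sits at position 3, which is position 1 of the second part.\<close>
  obtain u where u: "\<And>F x. run F u x = run (\<lambda>q. F (2 * q)) (prog_of (F 3)) x"
    by (rule universal_program[of "\<lambda>F q. F (2 * q)" "\<lambda>F x. F 3" "\<lambda>F x. x"])
      (intro comp_intros | blast)+
  have "transduces u (turing_join (turing_jump f) (turing_join f (emb i))) k"
    if "Delta2_index f i k" for f i k
  proof -
    have "turing_join F (turing_join f (emb i)) 3 = i" for F
      by (simp add: turing_join_def emb_def)
    then show ?thesis
      using that by (simp add: transduces_def u Delta2_index_def maps_to_def Phi_def)
  qed
  then have "uniformly_computable (\<lambda>F k. \<exists>f i.
      F = turing_join (turing_jump f) (turing_join f (emb i)) \<and> Delta2_index f i k)"
    unfolding uniformly_computable_def by blast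
  from uniformly_computable_comp[OF join this] have "uniformly_computable ?T"
  proof (rule uniformly_computable_mono)
    fix F k assume "?T F k"
    then obtain f i where "F = turing_jump (turing_join f (emb i))" "Delta2_index f i k" by blast
    then show "((\<lambda>F G. \<exists>f. F = turing_jump f \<and> G = turing_join (turing_jump (\<lambda>x. f (2 * x))) f) OO
        (\<lambda>F k. \<exists>f i. F = turing_join (turing_jump f) (turing_join f (emb i)) \<and>
          Delta2_index f i k)) F k"
      by (intro relcomppI[of _ _ "turing_join (turing_jump f) (turing_join f (emb i))"])
        (intro exI[of _ "turing_join f (emb i)"], simp, blast)
  qed
  from uniformly_computable_comp[OF uniformly_computable_iter_turing_jump[OF this] Suc]
  show ?case
  proof (rule uniformly_computable_mono)
    fix F g assume "\<exists>h. F = iter_turing_jump (Suc n) h \<and> represents (Suc n) h g"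
    then obtain f i k where "F = iter_turing_jump n (turing_jump (turing_join f (emb i)))"
      "Delta2_index f i k" "represents n k g"
      unfolding iter_turing_jump_Suc by auto
    then show "((\<lambda>F G. \<exists>f g. F = iter_turing_jump n f \<and> G = iter_turing_jump n g \<and> ?T f g) OO
        (\<lambda>F g. \<exists>h. F = iter_turing_jump n h \<and> represents n h g)) F g"
      by (intro relcomppI[of _ _ "iter_turing_jump n k"]) blast+
  qed
qed

text \<open>The computation is deferred to an index. The hypothesis for \<open>n\<close>, with the
  jump of \<open>f\<close> as oracle, supplies one \<open>i\<close> for all \<open>f\<close>, and
  \<langle>f, i\<rangle> is computable from \<open>f\<close>.\<close>

lemma uniformly_computable_representation:
  assumes "uniformly_computable (\<lambda>F k. \<exists>f. F = iter_turing_jump n f \<and> R f k)"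
  shows "\<exists>d. \<forall>f k. R f k \<longrightarrow> (\<exists>h. maps_to d f h \<and> represents n h k)"
  using assms
proof (induction n arbitrary: R)
  case 0
  then have "uniformly_computable R" by simp
  then obtain d where "\<And>f k. R f k \<Longrightarrow> maps_to d f k"
    by (rule uniformly_computable_index) blast
  then show ?case unfolding represents.simps by blast
next
  case (Suc n)
  have "uniformly_computable
      (\<lambda>F k. \<exists>f'. F = iter_turing_jump n f' \<and> (\<exists>f. f' = turing_jump f \<and> R f k))"
    by (rule uniformly_computable_mono[OF Suc.prems]) (simp only: iter_turing_jump_Suc, blast)
  from Suc.IH[OF this] obtain i
    where i: "\<And>f k. R f k \<Longrightarrow> \<exists>h. maps_to i (turing_jump f) h \<and> represents n h k"
    by metis
  have "computable (\<lambda>f. turing_join f (emb i))"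
    unfolding turing_join_def emb_def by (intro comp_intros)
  from uniformly_computable_index[OF uniformly_computable_total[OF this]]
  obtain d where d: "\<And>f. maps_to d f (turing_join f (emb i))" by metis
  have "\<exists>h. maps_to d f h \<and> represents (Suc n) h k" if R: "R f k" for f k
  proof -
    from i[OF R] obtain h where "Delta2_index f i h" "represents n h k"
      unfolding Delta2_index_def by (elim exE conjE)
    then have "represents (Suc n) (turing_join f (emb i)) k"
      by (simp only: represents.simps) (intro exI conjI, rule refl)
    with d show ?thesis by (intro exI conjI)
  qed
  then show ?case by blast
qed

section \<open>Choice on the natural numbers\<close>

lemma C_N_code_enumeration:
  assumes "proper_enumeration v"
  shows "C_N (code_enumeration v) = {emb i | i. Some i \<notin> range v}"
proof -
  have "v = w" if "code_enumeration v = code_enumeration w" for w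
  proof
    fix s
    from fun_cong[OF that, of s] show "v s = w s"
      by (simp add: code_enumeration_def split: option.splits)
  qed
  then show ?thesis using assms unfolding C_N_def by blast
qed

lemma instances_C_N:
  assumes "g \<in> instances C_N"
  obtains v where "g = code_enumeration v" "proper_enumeration v" "\<exists>i. Some i \<notin> range v"
  using assms unfolding instances_def C_N_def by blast

text \<open>The value \<open>c\<close> is enumerated at the unique stage \<open>pair c t\<close> for which \<open>t\<close> is the first refutation
  of \<open>c\<close>, since a proper enumeration must not repeat an earlier value.\<close>

lemma C_N_co_enumeration:
  assumes "decidable (\<lambda>f z. R f (pfst z) (psnd z))"
  obtains V where "computable V"
    "\<And>f. \<exists>c. \<forall>t. R f c t \<Longrightarrow> C_N (V f) = {emb c | c. \<forall>t. R f c t}"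
proof -
  define new where "new f m \<longleftrightarrow> \<not> R f (pfst m) (psnd m) \<and> (\<forall>t<psnd m. R f (pfst m) t)" for f m
  \<comment> \<open>\<open>W f k\<close> remembers the number refuted at the latest new stage before
    \<open>k\<close>, in the code of \<open>C_N\<close>, with 0 if there is none.\<close>
  define W where "W f k = rec_nat 0 (\<lambda>m r. if new f m then Suc (pfst m) else r) k" for f k
  \<comment> \<open>The shift makes a number refuted at stage \<open>s\<close> appear at position
    \<open>s\<close> itself.\<close>
  define V where "V f s = W f (Suc s)" for f s
  have R: "computable A \<Longrightarrow> computable B \<Longrightarrow> decidable (\<lambda>f z. R f (A f z) (B f z))" for A B
    using assms by (rule decidable_comp2)
  have "computable V"
    unfolding V_def W_def new_def by (intro comp_intros R)
  moreover have "C_N (V f) = {emb c | c. \<forall>t. R f c t}" if good: "\<exists>c. \<forall>t. R f c t" for f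
  proof -
    have uniq: "m = m'" if "new f m" "new f m'" "pfst m = pfst m'" for m m'
    proof -
      have "psnd m = psnd m'"
        using that unfolding new_def by (metis linorder_neqE_nat)
      with that(3) have "prod_decode m = prod_decode m'" by (simp add: prod_eq_iff)
      then show ?thesis by (metis prod_decode_inverse)
    qed
    have zero: "W f k = 0 \<longleftrightarrow> (\<forall>m<k. \<not> new f m)" for k
      by (induction k) (auto simp: W_def less_Suc_eq)
    have last: "\<exists>m<k. new f m \<and> pfst m = c \<and> (\<forall>r. m < r \<longrightarrow> r < k \<longrightarrow> \<not> new f r)"
      if "W f k = Suc c" for k c
      using that
    proof (induction k)
      case (Suc k)
      show ?case
      proof (cases "new f k")
        case True
        then show ?thesis using Suc.prems by (intro exI[of _ k]) (simp add: W_def)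
      next
        case False
        then have "W f k = Suc c" using Suc.prems by (simp add: W_def)
        with Suc.IH False show ?thesis by (metis less_Suc_eq)
      qed
    qed (simp add: W_def)
    have const: "W f k = W f j" if "j \<le> k" "\<forall>r. j \<le> r \<longrightarrow> r < k \<longrightarrow> \<not> new f r" for j k
      using that by (induction k rule: dec_induct) (simp_all add: W_def)
    define v where "v s = (case V f s of 0 \<Rightarrow> None | Suc i \<Rightarrow> Some i)" for s
    have code: "V f = code_enumeration v"
      by (rule ext) (simp add: v_def code_enumeration_def split: nat.split)
    have v_None: "v s = None \<longleftrightarrow> W f (Suc s) = 0" and v_Some: "v s = Some c \<longleftrightarrow> W f (Suc s) = Suc c"
      for s c by (simp_all add: v_def V_def split: nat.split)
    have range: "Some c \<notin> range v \<longleftrightarrow> (\<forall>t. R f c t)" for c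
    proof
      assume c: "Some c \<notin> range v"
      show "\<forall>t. R f c t"
      proof (rule ccontr)
        assume "\<not> (\<forall>t. R f c t)"
        then obtain t where t: "\<not> R f c t" "\<forall>t'<t. R f c t'"
          using exists_least_iff[of "\<lambda>t. \<not> R f c t"] by blast
        then have "new f (pair c t)" by (simp add: new_def)
        then have "v (pair c t) = Some c" by (simp add: v_Some W_def)
        with c show False by (metis rangeI)
      qed
    next
      assume c: "\<forall>t. R f c t"
      show "Some c \<notin> range v"
      proof
        assume "Some c \<in> range v"
        then obtain s where "v s = Some c" by (metis imageE)
        with last[of "Suc s" c] obtain m where "new f m" "pfst m = c" by (auto simp: v_Some)
        with c show False by (simp add: new_def)
      qed
    qed
    have "proper_enumeration v"
      unfolding proper_enumeration_def
    proof (intro conjI allI impI ballI)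
      show "\<not> range Some \<subseteq> range v" using good range by blast
      show "v t \<noteq> None" if "s < t \<and> v s \<noteq> None" for s t
        using that unfolding v_None zero by (metis Suc_less_eq less_trans)
      show "v r = v s" if st: "s < t \<and> v s = v t" and r: "r \<in> {s..t}" for s t r
      proof -
        \<comment> \<open>Equal values at \<open>s\<close> and \<open>t\<close> come from latest new
          stages for the same number. By \<open>uniq\<close> these coincide, so no new stage lies in
          between.\<close>
        have "\<not> new f u" if u: "Suc s \<le> u" "u < Suc t" for u
        proof (cases "v t")
          case None
          then show ?thesis using u by (simp add: v_None zero)
        next
          case (Some c)
          obtain m where m: "m < Suc s" "new f m" "pfst m = c"
            using last[of "Suc s" c] st Some by (auto simp: v_Some)
          obtain m' where m': "new f m'" "pfst m' = c"
            "\<forall>r. m' < r \<longrightarrow> r < Suc t \<longrightarrow> \<not> new f r"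
            using last[of "Suc t" c] Some by (auto simp: v_Some)
          have "m' = m" using uniq m m' by simp
          then show ?thesis using m(1) m'(3) u by simp
        qed
        then have "W f (Suc r) = W f (Suc s)" using r by (intro const) auto
        then show ?thesis by (simp add: v_def V_def)
      qed
    qed
    from C_N_code_enumeration[OF this] show ?thesis unfolding code range .
  qed
  ultimately show thesis by (rule that)
qed

section \<open>The first-order part\<close>

text \<open>Joins and \<open>emb\<close> are injective and \<open>maps_to\<close> is functional, so
  the instance fixes \<open>f\<close>, \<open>d\<close>, \<open>e\<close> and \<open>k\<close> in
  the definition.\<close>

lemma first_order_part_eq:
  assumes "maps_to d f k" "k \<in> instances P" "\<And>g. g \<in> P k \<Longrightarrow> Phi e (turing_join f g) 0 \<noteq> None"
  shows "first_order_part P (turing_join f (turing_join (emb d) (emb e))) =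
    {emb y | y g. g \<in> P k \<and> Phi e (turing_join f g) 0 = Some y}"
proof -
  have k: "k' = k" if "maps_to d f k'" for k'
    using that assms(1) unfolding maps_to_iff_transduces by (rule transduces_unique)
  have "first_order_instance P f d e"
    using assms unfolding first_order_instance_def by blast
  then show ?thesis
    unfolding first_order_part_def turing_join_inject emb_inject
    using assms(1) by (auto dest: k)
qed

lemma C_N_le_first_order_part_TJ: "iter_jump C_N n \<le>sW first_order_part (iter_jump TJ n)"
proof -
  have "uniformly_computable (\<lambda>f g. g = f)"
    by (rule uniformly_computable_total[OF computable_query[OF computable_id]])
  \<comment> \<open>The identity serves twice: as the functional inside the instance and as the
    outer postprocessing.\<close>
  then obtain d where d: "maps_to d f f" for f by (rule uniformly_computable_index) blast
  have "decidable (\<lambda>f z. f (psnd z) = Suc (pfst z))" by (intro comp_intros)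
  then obtain q where q: "run f q i = (if \<exists>s. f s = Suc i then Some (LEAST s. f s = Suc i) else None)"
    for f i by (rule search_program) blast
  obtain t where t: "computable (\<lambda>_. t)"
    "\<And>f x. turing_jump f (t x) = of_bool (run f q x \<noteq> None)"
    by (rule halting_index) blast
  \<comment> \<open>Odd positions hold the jump of the enumeration; a 0 at the index
    \<open>t i\<close> says that \<open>i\<close> is never enumerated.\<close>
  have "decidable (\<lambda>F z. F (Suc (2 * t (psnd z))) = 0)"
    by (intro comp_intros computable_comp[OF t(1)])
  then obtain p where p: "run F p x = (if \<exists>i. F (Suc (2 * t i)) = 0
      then Some (LEAST i. F (Suc (2 * t i)) = 0) else None)" for F and x :: nat
    by (rule search_program) blast
  obtain e where e: "prog_of e = p" using surj_prog_of by (metis surjD)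
  have "computable (\<lambda>f. turing_join f (turing_join (emb d) (emb e)))"
    unfolding turing_join_def emb_def by (intro comp_intros)
  from uniformly_computable_index[OF uniformly_computable_total[OF this]]
  obtain a where a: "\<And>f. maps_to a f (turing_join f (turing_join (emb d) (emb e)))" by metis
  have "\<exists>k. maps_to a h k \<and> k \<in> instances (first_order_part (iter_jump TJ n)) \<and>
      (\<forall>g\<in>first_order_part (iter_jump TJ n) k. \<exists>u. maps_to d g u \<and> u \<in> iter_jump C_N n h)"
    if h: "h \<in> instances (iter_jump C_N n)" for h
  proof -
    obtain g where g: "represents n h g" "g \<in> instances C_N"
      using instances_iter_jump[OF h] by blast
    obtain v where v: "g = code_enumeration v" "proper_enumeration v" "\<exists>i. Some i \<notin> range v"
      using g(2) by (rule instances_C_N)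
    \<comment> \<open>\<open>TJ\<close> is defined everywhere, so the same \<open>h\<close> is an
      instance of its iterated jump, without translation.\<close>
    have "g \<in> instances TJ" by (simp add: instances_def TJ_def)
    with g(1) have TJ: "iter_jump TJ n h = {turing_jump g}"
      by (simp add: iter_jump_represents TJ_def)
    have C: "iter_jump C_N n h = {emb i | i. Some i \<notin> range v}"
      using iter_jump_represents[OF g] C_N_code_enumeration[OF v(2)] v(1) by simp
    have "g s = Suc i \<longleftrightarrow> v s = Some i" for s i
      by (simp add: v(1) code_enumeration_def split: option.split)
    then have "turing_join h (turing_jump g) (Suc (2 * t i)) = 0 \<longleftrightarrow> Some i \<notin> range v" for i
      by (auto simp: t(2) q) (metis rangeI)
    then have val: "Phi e (turing_join h (turing_jump g)) 0 = Some (LEAST i. Some i \<notin> range v)"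
      using v(3) by (simp add: Phi_def e p)
    have "first_order_part (iter_jump TJ n) (turing_join h (turing_join (emb d) (emb e))) =
        {emb y | y g. g \<in> iter_jump TJ n h \<and> Phi e (turing_join h g) 0 = Some y}"
      using d by (rule first_order_part_eq) (simp_all add: instances_def TJ val)
    also have "\<dots> = {emb (LEAST i. Some i \<notin> range v)}"
      using val by (auto simp: TJ)
    finally have F: "first_order_part (iter_jump TJ n) (turing_join h (turing_join (emb d) (emb e))) =
        {emb (LEAST i. Some i \<notin> range v)}" .
    have "emb (LEAST i. Some i \<notin> range v) \<in> iter_jump C_N n h"
      using LeastI_ex[OF v(3)] by (auto simp: C)
    then show ?thesis
      using a d F by (intro exI[of _ "turing_join h (turing_join (emb d) (emb e))"])
        (auto simp: instances_def)
  qed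
  then show ?thesis unfolding sW_le_def by blast
qed

text \<open>The oracle \<open>K\<close> is \<open>\<langle>\<langle>f, \<langle>d, e\<rangle>\<rangle>, g\<rangle>\<close>, and \<open>c\<close> codes a certificate for the computation of
  \<open>\<Psi>(f, g')(0)\<close> together with a bound for witnesses of the positive answers of \<open>g'\<close>. Only the negative
  answers can be refuted later, namely by \<open>s\<close>.\<close>

definition unrefuted :: "baire \<Rightarrow> nat \<Rightarrow> nat \<Rightarrow> bool" where
  "unrefuted K c s \<longleftrightarrow>
    (let g = (\<lambda>j. K (Suc (2 * j))); N = psnd (pfst c) in
      fact_code (K 6) 0 (pfst (pfst c)) \<in> set (list_decode N) \<and> derivation (list_decode N) \<and>
      (\<forall>q<N. \<forall>a<N. fact_code 4 q a \<in> set (list_decode N) \<longrightarrow>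
        (if even q then a = K (2 * (2 * (q div 2)))
         else a = 1 \<and> (\<exists>w<psnd c. certifies g (q div 2) (q div 2) w) \<or>
           a = 0 \<and> \<not> certifies g (q div 2) (q div 2) s)))"

lemma decidable_unrefuted: "decidable (\<lambda>K z. unrefuted K (pfst z) (psnd z))"
  unfolding unrefuted_def Let_def by (intro comp_intros)

lemma turing_jump_eq_0_iff: "turing_jump g j = 0 \<longleftrightarrow> (\<forall>s. \<not> certifies g j j s)"
  and turing_jump_eq_1_iff: "turing_jump g j = 1 \<longleftrightarrow> (\<exists>s. certifies g j j s)"
proof -
  have "Phi j g j \<noteq> None \<longleftrightarrow> (\<exists>s. certifies g j j s)"
    unfolding Phi_def using certifies_sound certifies_complete by fastforce
  then show "turing_jump g j = 0 \<longleftrightarrow> (\<forall>s. \<not> certifies g j j s)"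
    and "turing_jump g j = 1 \<longleftrightarrow> (\<exists>s. certifies g j j s)"
    by (simp_all add: turing_jump_def)
qed

context
  fixes f g K :: baire and d e :: nat
  assumes K: "K = turing_join (turing_join f (turing_join (emb d) (emb e))) g"
begin

lemma oracle_simps: "K 6 = e" "K (2 * (2 * j)) = f j" "(\<lambda>j. K (Suc (2 * j))) = g"
proof -
  \<comment> \<open>Position 6 of \<open>K\<close> is position 3 of its first part, hence position 1
    of \<langle>d, e\<rangle>.\<close>
  show "K 6 = e" by (simp add: K turing_join_def emb_def)
qed (simp_all only: K turing_join_even turing_join_odd)

lemma unrefuted_sound:
  assumes "\<forall>s. unrefuted K c s"
  shows "Phi e (turing_join f (turing_jump g)) 0 = Some (pfst (pfst c))"
proof -
  let ?N = "psnd (pfst c)"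
  have u: "fact_code e 0 (pfst (pfst c)) \<in> set (list_decode ?N)" "derivation (list_decode ?N)"
    "\<And>s q a. q < ?N \<Longrightarrow> a < ?N \<Longrightarrow> fact_code 4 q a \<in> set (list_decode ?N) \<Longrightarrow>
        (if even q then a = f (q div 2)
         else a = 1 \<and> (\<exists>w<psnd c. certifies g (q div 2) (q div 2) w) \<or>
           a = 0 \<and> \<not> certifies g (q div 2) (q div 2) s)"
    using assms unfolding unrefuted_def Let_def oracle_simps by blast+
  have "turing_join f (turing_jump g) q = a" if "fact_code 4 q a \<in> set (list_decode ?N)" for q a
  proof (cases "even q")
    case True
    then show ?thesis using u(3)[OF _ _ that] in_set_decode_bound[OF that]
      by (simp add: turing_join_def)
  next
    case False
    \<comment> \<open>The answer \<open>a\<close> does not depend on \<open>s\<close>, so the same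
      disjunct holds throughout and the quantifier moves inside.\<close>
    have "a = 1 \<and> (\<exists>w<psnd c. certifies g (q div 2) (q div 2) w) \<or>
        a = 0 \<and> (\<forall>s. \<not> certifies g (q div 2) (q div 2) s)"
      using u(3)[OF _ _ that] in_set_decode_bound[OF that] False by auto
    then have "turing_jump g (q div 2) = a"
      using turing_jump_eq_0_iff turing_jump_eq_1_iff by metis
    then show ?thesis using False by (simp add: turing_join_def)
  qed
  then have "certifies (turing_join f (turing_jump g)) e 0 (pfst c)"
    using u(1,2) by (simp add: certifies_def queries_correct_def)
  then show ?thesis unfolding Phi_def by (rule certifies_sound)
qed

lemma unrefuted_complete:
  assumes "Phi e (turing_join f (turing_jump g)) 0 = Some y"
  shows "\<exists>c. \<forall>s. unrefuted K c s"
proof -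
  obtain L where L: "certifies (turing_join f (turing_jump g)) e 0 (pair y (list_encode L))"
    using certifies_complete assms unfolding Phi_def by blast
  define N where "N = list_encode L"
  have "\<exists>w. turing_jump g j = 1 \<longrightarrow> certifies g j j w" for j
    using turing_jump_eq_1_iff by blast
  then obtain w where w: "\<And>j. turing_jump g j = 1 \<Longrightarrow> certifies g j j (w j)" by metis
  \<comment> \<open>A query \<open>q < N\<close> concerns the jump at \<open>q div 2\<close>, so one
    bound for the witnesses up to \<open>N\<close> covers them all.\<close>
  define B where "B = Suc (Max (w ` {..N}))"
  have B: "w j < B" if "j \<le> N" for j
    using that by (simp add: B_def less_Suc_eq_le)
  have "unrefuted K (pair (pair y N) B) s" for s
    unfolding unrefuted_def Let_def oracle_simps
  proof (simp only: prod_encode_inverse fst_conv snd_conv, intro conjI allI impI)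
    show "fact_code e 0 y \<in> set (list_decode N)" "derivation (list_decode N)"
      using L by (simp_all add: certifies_def N_def)
    fix q a assume q: "q < N" and fact: "fact_code 4 q a \<in> set (list_decode N)"
    have a: "turing_join f (turing_jump g) q = a"
      using L fact by (auto simp: certifies_def N_def queries_correct_def)
    show "if even q then a = f (q div 2)
         else a = 1 \<and> (\<exists>w<B. certifies g (q div 2) (q div 2) w) \<or>
           a = 0 \<and> \<not> certifies g (q div 2) (q div 2) s"
    proof (cases "even q")
      case True
      then show ?thesis using a by (simp add: turing_join_def)
    next
      case False
      then have a: "turing_jump g (q div 2) = a" using a by (simp add: turing_join_def)
      have "a = 0 \<or> a = 1" using a by (auto simp: turing_jump_def split: if_splits)
      then show ?thesis
      proof
        assume "a = 0"
        then show ?thesis using a False turing_jump_eq_0_iff by simp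
      next
        assume "a = 1"
        moreover from this have "certifies g (q div 2) (q div 2) (w (q div 2))" using a w by simp
        moreover have "w (q div 2) < B" using q by (intro B) linarith
        ultimately show ?thesis using False by auto
      qed
    qed
  qed
  then show ?thesis by blast
qed

end

lemma first_order_part_TJ_le_C_N: "first_order_part (iter_jump TJ n) \<le>sW iter_jump C_N n"
proof -
  define inst where "inst h f d e k \<longleftrightarrow>
    h = turing_join f (turing_join (emb d) (emb e)) \<and> maps_to d f k" for h f d e k
  obtain V where V: "computable V" "\<And>K. \<exists>c. \<forall>s. unrefuted K c s \<Longrightarrow>
      C_N (V K) = {emb c | c. \<forall>s. unrefuted K c s}"
    using C_N_co_enumeration[OF decidable_unrefuted] by blast
  \<comment> \<open>Position 1 of the instance holds \<open>d\<close>, the index of the inner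
    functional, and the even positions hold its oracle \<open>f\<close>.\<close>
  obtain u where u: "\<And>F x. run F u x = run (\<lambda>q. F (2 * q)) (prog_of (F 1)) x"
    by (rule universal_program[of "\<lambda>F q. F (2 * q)" "\<lambda>F x. F 1" "\<lambda>F x. x"])
      (intro comp_intros | blast)+
  have "transduces u h k" if "inst h f d e k" for h f d e k
  proof -
    have "h 1 = d" "(\<lambda>q. h (2 * q)) = f"
      using that by (simp_all add: inst_def turing_join_def emb_def)
    then show ?thesis using that by (simp add: transduces_def u inst_def maps_to_def Phi_def)
  qed
  then have "uniformly_computable (\<lambda>h k. \<exists>f d e. inst h f d e k)"
    unfolding uniformly_computable_def by blast
  from uniformly_computable_comp[OF uniformly_computable_iter_turing_jump[OF this]
      uniformly_computable_represented]
  have "uniformly_computable (\<lambda>F g. \<exists>h f d e k. F = iter_turing_jump n h \<and> inst h f d e k \<and>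
      represents n k g)"
    by (rule uniformly_computable_mono) blast
  \<comment> \<open>The oracle of \<open>V\<close> needs \<open>h\<close> beside \<open>g\<close>,
    since refutation consults \<open>f\<close> and \<open>e\<close>; the iterated jump of
    \<open>h\<close> supplies both.\<close>
  from uniformly_computable_comp[OF
      uniformly_computable_join[OF uniformly_computable_from_iter_turing_jump this]
      uniformly_computable_total[OF V(1)]]
  have "uniformly_computable (\<lambda>F G. \<exists>h. F = iter_turing_jump n h \<and>
      (\<exists>f d e k g. inst h f d e k \<and> represents n k g \<and> G = V (turing_join h g)))"
  proof (rule uniformly_computable_mono, elim exE conjE)
    fix F G h f d e k g
    assume "F = iter_turing_jump n h" "inst h f d e k" "represents n k g" "G = V (turing_join h g)"
    then show "((\<lambda>F K. \<exists>h g. K = turing_join h g \<and> F = iter_turing_jump n h \<and>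
        (\<exists>h f d e k. F = iter_turing_jump n h \<and> inst h f d e k \<and> represents n k g)) OO
        (\<lambda>K G. G = V K)) F G"
      by (intro relcomppI[of _ _ "turing_join h g"]) blast+
  qed
  from uniformly_computable_representation[OF this] obtain a
    where a: "\<And>h f d e k g. inst h f d e k \<Longrightarrow> represents n k g \<Longrightarrow>
      \<exists>l. maps_to a h l \<and> represents n l (V (turing_join h g))"
    by metis
  \<comment> \<open>A strong reduction decodes the solution without access to \<open>h\<close>; this
    is possible because the certificate \<open>c\<close> carries the output itself.\<close>
  have "computable (\<lambda>g x. if x = 0 then pfst (pfst (g 0)) else 0)" by (intro comp_intros)
  from uniformly_computable_index[OF uniformly_computable_total[OF this]]
  obtain b where b: "\<And>g. maps_to b g (\<lambda>x. if x = 0 then pfst (pfst (g 0)) else 0)" by metis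
  have b: "maps_to b (emb c) (emb (pfst (pfst c)))" for c
  proof -
    have "(\<lambda>x. if x = 0 then pfst (pfst (emb c 0)) else 0) = emb (pfst (pfst c))"
      by (auto simp: emb_def)
    then show ?thesis using b[of "emb c"] by (simp only:)
  qed
  have "\<exists>l. maps_to a h l \<and> l \<in> instances (iter_jump C_N n) \<and>
      (\<forall>g\<in>iter_jump C_N n l. \<exists>u. maps_to b g u \<and> u \<in> first_order_part (iter_jump TJ n) h)"
    if "h \<in> instances (first_order_part (iter_jump TJ n))" for h
  proof -
    from that obtain f d e where h: "h = turing_join f (turing_join (emb d) (emb e))"
      and "first_order_instance (iter_jump TJ n) f d e"
      unfolding instances_def first_order_part_def by blast
    then obtain k where k: "maps_to d f k" "k \<in> instances (iter_jump TJ n)"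
      and halt: "\<And>g. g \<in> iter_jump TJ n k \<Longrightarrow> Phi e (turing_join f g) 0 \<noteq> None"
      unfolding first_order_instance_def by blast
    obtain g where g: "represents n k g" "g \<in> instances TJ"
      using instances_iter_jump[OF k(2)] by blast
    have TJ: "iter_jump TJ n k = {turing_jump g}"
      using iter_jump_represents[OF g] by (simp add: TJ_def)
    obtain y where y: "Phi e (turing_join f (turing_jump g)) 0 = Some y"
      using halt[of "turing_jump g"] TJ by auto
    have "first_order_part (iter_jump TJ n) h =
        {emb y | y g. g \<in> iter_jump TJ n k \<and> Phi e (turing_join f g) 0 = Some y}"
      unfolding h using k halt by (rule first_order_part_eq)
    with TJ y have sol: "emb y \<in> first_order_part (iter_jump TJ n) h" by blast
    define K where "K = turing_join h g"
    note K = K_def[unfolded h]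
    have ex: "\<exists>c. \<forall>s. unrefuted K c s" using K y by (rule unrefuted_complete)
    have "inst h f d e k" using h k(1) by (simp add: inst_def)
    from a[OF this g(1)] obtain l where l: "maps_to a h l" "represents n l (V K)"
      unfolding K_def[symmetric] by (elim exE conjE)
    have VK: "C_N (V K) = {emb c | c. \<forall>s. unrefuted K c s}" using ex by (rule V(2))
    have nonempty: "{emb c | c. \<forall>s. unrefuted K c s} \<noteq> {}" using ex by simp
    then have "V K \<in> instances C_N" by (simp only: instances_def VK mem_Collect_eq) simp
    with l(2) have C: "iter_jump C_N n l = {emb c | c. \<forall>s. unrefuted K c s}"
      unfolding VK[symmetric] by (rule iter_jump_represents)
    have "\<exists>u. maps_to b x u \<and> u \<in> first_order_part (iter_jump TJ n) h"
      if "x \<in> iter_jump C_N n l" for x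
    proof -
      from that obtain c where c: "x = emb c" "\<forall>s. unrefuted K c s"
        unfolding C mem_Collect_eq by (elim exE conjE)
      have "pfst (pfst c) = y" using unrefuted_sound[OF K c(2)] y by simp
      with b[of c] sol show ?thesis unfolding c(1) by (intro exI conjI) simp_all
    qed
    moreover have "l \<in> instances (iter_jump C_N n)"
      using nonempty by (simp only: instances_def C mem_Collect_eq) simp
    ultimately show ?thesis using l(1) by (intro exI[of _ l]) simp
  qed
  then show ?thesis unfolding sW_le_def by blast
qed

theorem theorem4p2:
  fixes n :: nat
  shows "first_order_part (iter_jump TJ n) \<equiv>sW iter_jump C_N n"
  unfolding sW_equiv_def
  by (intro conjI first_order_part_TJ_le_C_N C_N_le_first_order_part_TJ)

end
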